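(* Let $r\ge2$, let $a_1,\dots,a_r$ be pairwise distinct real numbers, and let $(\mathbf n^{(N)})_{N\in\mathbb N}$ be a path-like sequence of multi-indices in $\mathbb N^r$ with limiting proportions $q_1,\dots,q_r\in(0,1)$ (see context). Let $\nu_N$ be the zero probability distribution of the rescaled multiple Hermite polynomial $x\mapsto H_N^{(\sqrt N a_1,\dots,\sqrt N a_r)}(\sqrt N x)$. Then the weak limit $\nu$ of $\nu_N$ as $N\to\infty$, namely $\nu=\mu_{\mathrm{SC}}\boxplus\big(\sum_{j=1}^r q_j\delta_{a_j}\big)$, has a Cauchy–Stieltjes transform $G(z)=\int\frac{\nu(\mathrm dx)}{z-x}$ which satisfies the algebraic equation $$P\big(z,G(z)\big)=0,\qquad z\in\mathbb C\setminus\mathrm{supp}(\nu),$$ where $$P(z,w)=w\prod_{i=1}^r(z-w-a_i)-\sum_{i=1}^r q_i\prod_{j=1,\,j\ne i}^r(z-w-a_j).$$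
   Context: $\mathbb N=\{0,1,2,\dots\}$. Path-like sequence: multi-indices $\mathbf n^{(N)}=(n_1^{(N)},\dots,n_r^{(N)})\in\mathbb N^r$, $N\in\mathbb N$, such that (a) $\sum_{i=1}^r n_i^{(N)}=N$ for every $N$; (b) $n_i^{(N+1)}\ge n_i^{(N)}$ for every $N$ and $1\le i\le r$; (c) there is $R\in\mathbb N$ such that $n_i^{(N+R)}\ge n_i^{(N)}+1$ for every $N$ and $1\le i\le r$; (d) there are $q_1,\dots,q_r\in(0,1)$ with $\lim_{N\to\infty}n_i^{(N)}/N=q_i$ for $1\le i\le r$. Multiple Hermite polynomial: for pairwise distinct reals $b_1,\dots,b_r$, $H_N^{(b_1,\dots,b_r)}$ is the unique monic polynomial of degree $N$ such that for every $1\le j\le r$, $$\int_{\mathbb R}x^kH_N^{(b_1,\dots,b_r)}(x)\,e^{b_jx}e^{-x^2/2}\,\mathrm dx=0,\qquad 0\le k\le n_j^{(N)}-1$$ (for these weights existence and uniqueness hold for every multi-index). The zero probability distribution of a polynomial of degree $N$ with complex zeros $z_1,\dots,z_N$ (with multiplicity) is $\frac1N\sum_{i=1}^N\delta_{z_i}$. $\mu_{\mathrm{SC}}(\mathrm dx)=\frac1{2\pi}\sqrt{4-x^2}\,\mathbf 1_{[-2,2]}(x)\,\mathrm dx$ is the semi-circle distribution. Free additive convolution: for a compactly supported probability measure $\lambda$ on $\mathbb R$, let $G_\lambda(z)=\int\frac{\lambda(\mathrm dx)}{z-x}=\sum_{k\ge0}\big(\int x^k\lambda(\mathrm dx)\big)z^{-k-1}$,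 let $K_\lambda$ be its inverse for composition of formal series, and $R_\lambda(z)=K_\lambda(z)-\frac1z$. For compactly supported probability measures $\lambda,\eta$ on $\mathbb R$, $\lambda\boxplus\eta$ is the unique compactly supported probability measure on $\mathbb R$ with $R_{\lambda\boxplus\eta}=R_\lambda+R_\eta$. *)

theory Defs
  imports
    "HOL-Probability.Probability"
    "HOL-Computational_Algebra.Computational_Algebra"
begin

section \<open>Path-like sequences and multiple Hermite polynomials\<close>

text \<open>A multi-index in \<open>\<nat>\<^sup>r\<close> is a function \<open>nat \<Rightarrow> nat\<close> of which only the values on
  \<open>{1..r}\<close> matter; likewise for real \<open>r\<close>-tuples. The component \<open>n\<^sub>i\<close> of the \<open>N\<close>-th
  multi-index is \<open>n N i\<close>.\<close>

definition path_like :: "nat \<Rightarrow> (nat \<Rightarrow> nat \<Rightarrow> nat) \<Rightarrow> (nat \<Rightarrow> real) \<Rightarrow> bool" where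
  "path_like r n q \<longleftrightarrow>
     (\<forall>N. (\<Sum>i=1..r. n N i) = N) \<and>
     (\<forall>N. \<forall>i\<in>{1..r}. n (Suc N) i \<ge> n N i) \<and>
     (\<exists>R. \<forall>N. \<forall>i\<in>{1..r}. n (N + R) i \<ge> n N i + 1) \<and>
     (\<forall>i\<in>{1..r}. 0 < q i \<and> q i < 1 \<and> (\<lambda>N. real (n N i) / real N) \<longlonglongrightarrow> q i)"

text \<open>The integrals below converge absolutely for every polynomial \<open>p\<close>, so the convention that
  a non-integrable function has integral zero plays no role.\<close>

definition is_multiple_hermite :: "nat \<Rightarrow> (nat \<Rightarrow> real) \<Rightarrow> (nat \<Rightarrow> nat) \<Rightarrow> real poly \<Rightarrow> bool" where
  "is_multiple_hermite r b m p \<longleftrightarrow>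
     lead_coeff p = 1 \<and> degree p = (\<Sum>i=1..r. m i) \<and>
     (\<forall>j\<in>{1..r}. \<forall>k<m j.
        (LBINT x. x ^ k * poly p x * exp (b j * x) * exp (- x\<^sup>2 / 2)) = 0)"

definition multiple_hermite :: "nat \<Rightarrow> (nat \<Rightarrow> real) \<Rightarrow> (nat \<Rightarrow> nat) \<Rightarrow> real poly" where
  "multiple_hermite r b m = (THE p. is_multiple_hermite r b m p)"


section \<open>Zero distributions and weak convergence\<close>

text \<open>The library multiset \<open>proots p\<close> lists the complex zeros with multiplicity, and
  \<open>pmf_of_multiset\<close> gives each point its relative multiplicity. A constant polynomial has no
  zeros and its zero distribution is unspecified.\<close>

definition zero_distribution :: "complex poly \<Rightarrow> complex measure" where
  "zero_distribution p = distr (measure_pmf (pmf_of_multiset (proots p))) borel (\<lambda>z. z)"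

definition converges_weakly :: "(nat \<Rightarrow> 'a::topological_space measure) \<Rightarrow> 'a measure \<Rightarrow> bool" where
  "converges_weakly M L \<longleftrightarrow>
     (\<forall>f :: 'a \<Rightarrow> real. continuous_on UNIV f \<longrightarrow> bounded (range f) \<longrightarrow>
        (\<lambda>N. \<integral>x. f x \<partial>M N) \<longlonglongrightarrow> (\<integral>x. f x \<partial>L))"


section \<open>Measures on the real line and free additive convolution\<close>

definition semicircle :: "real measure" where
  "semicircle = density lborel (\<lambda>x. ennreal (indicator {-2..2} x * (sqrt (4 - x\<^sup>2) / (2 * pi))))"

text \<open>The measure \<open>\<Sum>j=1..r. q j \<cdot> \<delta>(a j)\<close>.\<close>

definition atomic_measure :: "nat \<Rightarrow> (nat \<Rightarrow> real) \<Rightarrow> (nat \<Rightarrow> real) \<Rightarrow> real measure" where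
  "atomic_measure r q a = distr (point_measure {1..r} (\<lambda>j. ennreal (q j))) borel a"

definition measure_support :: "'a::topological_space measure \<Rightarrow> 'a set" where
  "measure_support M = {x. \<forall>U. open U \<longrightarrow> x \<in> U \<longrightarrow> emeasure M U > 0}"

definition compactly_supported_prob :: "real measure \<Rightarrow> bool" where
  "compactly_supported_prob M \<longleftrightarrow> real_distribution M \<and> compact (measure_support M)"

definition cauchy_transform :: "real measure \<Rightarrow> complex \<Rightarrow> complex" where
  "cauchy_transform M z = (\<integral>x. 1 / (z - complex_of_real x) \<partial>M)"

text \<open>The formal series \<open>G(z) = \<Sum>k. m\<^sub>k z\<^sup>-\<^sup>k\<^sup>-\<^sup>1\<close>, with \<open>m\<^sub>k\<close> the \<open>k\<close>-th moment, is encoded as the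
  power series \<open>g(u) = \<Sum>k. m\<^sub>k u\<^sup>k\<^sup>+\<^sup>1\<close> in the variable \<open>u = 1/z\<close>, so \<open>G(z) = g(1/z)\<close>. If \<open>h\<close> is
  the compositional inverse of \<open>g\<close>, then the compositional inverse of \<open>G\<close> is \<open>K = 1/h\<close>, a
  Laurent series with a simple pole.\<close>

definition cauchy_series :: "real measure \<Rightarrow> real fps" where
  "cauchy_series M = fps_X * Abs_fps (\<lambda>k. \<integral>x. x ^ k \<partial>M)"

definition K_series :: "real measure \<Rightarrow> real fls" where
  "K_series M = inverse (fps_to_fls (fps_inv (cauchy_series M)))"

definition R_transform :: "real measure \<Rightarrow> real fls" where
  "R_transform M = K_series M - inverse fls_X"

definition free_additive_convolution :: "real measure \<Rightarrow> real measure \<Rightarrow> real measure"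
    (infixl "\<boxplus>" 65) where
  "L \<boxplus> M = (THE \<rho>. compactly_supported_prob \<rho> \<and>
                    R_transform \<rho> = R_transform L + R_transform M)"

end

theory Submission
  imports Defs "HOL-Real_Asymp.Real_Asymp" "HOL-Complex_Analysis.Complex_Analysis"
begin

text \<open>
  The polynomials are governed by the heat flow. Integration by parts shows that the operator
  \<open>p \<mapsto> (x - b) p - p'\<close> raises the order of orthogonality to the weight \<open>e\<^sup>b\<^sup>x e\<^sup>-\<^sup>x\<^sup>2\<^sup>/\<^sup>2\<close> by one, and this operator
  is multiplication by \<open>x - b\<close> conjugated by \<open>exp(-D\<^sup>2/2)\<close>. Hence the multiple Hermite polynomial is
  \<open>H\<^sub>n = exp(-D\<^sup>2/2) \<Prod>(x - b\<^sub>j)\<^bsup>n\<^sub>j\<^esup>\<close> (\<open>multiple_hermite_eq\<close>), and with the unit vectors \<open>e(j)\<close> two relations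
  follow: \<open>H\<^sub>n = (x - b\<^sub>j) H\<^bsub>n - e(j)\<^esub> - H'\<^bsub>n - e(j)\<^esub>\<close> and \<open>H'\<^sub>n = \<Sum> n\<^sub>j H\<^bsub>n - e(j)\<^esub>\<close>.

  Let \<open>Q\<^sub>n\<close> be the rescaled polynomials and \<open>G\<^sub>n = Q\<^sub>n' / (N Q\<^sub>n)\<close>. The two relations combine to
  \<open>G\<^sub>n(z) = \<Sum> (n\<^sub>j / N) / (z - a\<^sub>j - G\<^bsub>n - e(j)\<^esub>(z))\<close> (\<open>zero_stieltjes_rec\<close>).
  Everything about the zeros is extracted from this identity by induction.
  Invariant half planes show that the zeros are real, and an invariant disc shows that they stay bounded
  (\<open>rescaled_hermite_invariant\<close>). For large \<open>z\<close> the maps \<open>w \<mapsto> 1 / (z - a\<^sub>j - w)\<close> are contractions, so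
  shifting the multi-index changes \<open>G\<^sub>n\<close> by at most \<open>1/N\<close>, and \<open>G\<^sub>n\<close> is an approximate solution of
  \<open>w = \<Sum> q\<^sub>j / (z - a\<^sub>j - w)\<close> (\<open>zero_stieltjes_approx\<close>). Clearing denominators, this equation is \<open>P(z, w) = 0\<close>.

  The zero distributions are tight, and the Cauchy transform of every weak limit \<open>M\<close> solves that equation
  near infinity. With \<open>\<eta> = \<Sum> q\<^sub>j \<delta>(a\<^sub>j)\<close> the equation reads \<open>G\<^sub>M(z) = G\<^sub>\<eta>(z - G\<^sub>M(z))\<close>, and inverting it for
  composition yields \<open>K\<^sub>M(w) = K\<^sub>\<eta>(w) + w\<close> (\<open>K_series_subordination\<close>). The R-transform of the semicircle
  distribution is \<open>w\<close> (\<open>R_transform_semicircle\<close>), so \<open>M\<close> has the R-transform prescribed for the free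
  convolution. A compactly supported law is determined by its R-transform (\<open>R_transform_determines\<close>).
  Therefore the convolution exists, all weak limits equal it, and the whole sequence converges. Finally,
  the Cauchy transform is holomorphic on the complement of the support, which is connected, and the
  algebraic equation extends to it by analytic continuation.
\<close>

section \<open>Multiple Hermite polynomials through the heat flow\<close>

text \<open>The operator \<open>(x - b) - d/dx\<close>; up to sign it is \<open>d/dx\<close> conjugated by multiplication with the
  weight \<open>e\<^sup>b\<^sup>x e\<^sup>-\<^sup>x\<^sup>2\<^sup>/\<^sup>2\<close>.\<close>

definition hermite_step :: "real \<Rightarrow> real poly \<Rightarrow> real poly" where
  "hermite_step b p = [:-b, 1:] * p - pderiv p"

lemma hermite_step_0 [simp]: "hermite_step b 0 = 0"
  by (simp add: hermite_step_def)

lemma hermite_step_add: "hermite_step b (p + q) = hermite_step b p + hermite_step b q"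
  by (simp add: hermite_step_def algebra_simps pderiv_add smult_add_right)

lemma hermite_step_smult: "hermite_step b (smult c p) = smult c (hermite_step b p)"
  by (simp add: hermite_step_def smult_diff_right pderiv_smult)

text \<open>Operators with different parameters differ by a scalar. This is how orthogonality with respect
  to one weight is carried past the operator that belongs to another.\<close>

lemma hermite_step_shift: "hermite_step b p = hermite_step c p + smult (c - b) p"
  by (simp add: hermite_step_def smult_diff_left)

lemma pderiv_hermite_step: "pderiv (hermite_step b p) = p + hermite_step b (pderiv p)"
  by (simp add: hermite_step_def pderiv_diff pderiv_mult pderiv_pCons pderiv_add pderiv_smult
      algebra_simps)

lemma coeff_hermite_step:
  "coeff (hermite_step b p) (Suc k) = coeff p k - b * coeff p (Suc k) - of_nat (k +
      2) * coeff p (k + 2)"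
  by (simp add: hermite_step_def coeff_pderiv)

lemma degree_hermite_step:
  assumes "p \<noteq> 0"
  shows "degree (hermite_step b p) = Suc (degree p)"
proof (rule antisym)
  show "degree (hermite_step b p) \<le> Suc (degree p)"
    by (rule degree_le) (auto simp: hermite_step_def coeff_pderiv coeff_pCons coeff_eq_0
        split: nat.splits)
  have "coeff (hermite_step b p) (Suc (degree p)) = lead_coeff p"
    by (simp add: coeff_hermite_step coeff_eq_0)
  thus "Suc (degree p) \<le> degree (hermite_step b p)"
    using assms by (intro le_degree) simp
qed

text \<open>This is \<open>exp(-D\<^sup>2/2)\<close> with \<open>D = d/dx\<close>. The recursion over the coefficients encodes the commutation
  rule \<open>exp(-D\<^sup>2/2) x = (x - D) exp(-D\<^sup>2/2)\<close>.\<close>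

definition backward_heat :: "real poly \<Rightarrow> real poly" where
  "backward_heat p = fold_coeffs (\<lambda>c s. [:c:] + hermite_step 0 s) p 0"

lemma backward_heat_0 [simp]: "backward_heat 0 = 0"
  by (simp add: backward_heat_def)

lemma backward_heat_pCons: "backward_heat (pCons c p) = [:c:] + hermite_step 0 (backward_heat p)"
  by (cases "p = 0 \<and> c = 0") (auto simp: backward_heat_def)

lemma backward_heat_add: "backward_heat (p + q) = backward_heat p + backward_heat q"
proof (induction p arbitrary: q)
  case (pCons c p)
  show ?case
    by (cases q) (simp add: backward_heat_pCons pCons.IH hermite_step_add)
qed simp

lemma backward_heat_smult: "backward_heat (smult c p) = smult c (backward_heat p)"
  by (induction p) (auto simp: backward_heat_pCons hermite_step_smult smult_add_right)

lemma backward_heat_sum: "backward_heat (\<Sum>i\<in>I. f i) = (\<Sum>i\<in>I. backward_heat (f i))"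
  by (induction I rule: infinite_finite_induct) (auto simp: backward_heat_add)

lemma pderiv_backward_heat: "pderiv (backward_heat p) = backward_heat (pderiv p)"
  by (induction p)
     (auto simp: backward_heat_pCons pderiv_pCons pderiv_add pderiv_hermite_step backward_heat_add)

text \<open>Multiplication operators commute, and this intertwining transports that to the operators
  \<open>hermite_step b\<close>: products of linear factors become products of such operators, in any order.\<close>

lemma backward_heat_linear_factor: "backward_heat ([:-b, 1:] * p) = hermite_step b (backward_heat p)"
proof -
  have "[:-b, 1:] * p = smult (- b) p + pCons 0 p"
    by simp
  thus ?thesis
    by (simp only: backward_heat_add backward_heat_smult backward_heat_pCons)
       (simp add: hermite_step_shift[of b _ 0])
qed

lemma backward_heat_lead: "degree (backward_heat p) \<le> degree p \<and>
    coeff (backward_heat p) (degree p) = lead_coeff p"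
proof (induction p)
  case (pCons c p)
  show ?case
  proof (cases "p = 0")
    case False
    have "degree (hermite_step 0 (backward_heat p)) \<le> Suc (degree p)"
      using degree_hermite_step[of "backward_heat p" 0] pCons.IH
      by (cases "backward_heat p = 0") auto
    thus ?thesis using False pCons.IH
      by (auto simp: backward_heat_pCons coeff_hermite_step coeff_eq_0 intro!: degree_add_le)
  qed (auto simp: backward_heat_pCons)
qed simp

definition hermite_poly :: "nat \<Rightarrow> (nat \<Rightarrow> real) \<Rightarrow> (nat \<Rightarrow> nat) \<Rightarrow> real poly" where
  "hermite_poly r b m = backward_heat (\<Prod>i=1..r. [:- b i, 1:] ^ m i)"

lemma lead_coeff_hermite_poly: "lead_coeff (hermite_poly r b m) = 1"
  and degree_hermite_poly: "degree (hermite_poly r b m) = (\<Sum>i=1..r. m i)"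
proof -
  let ?p = "\<Prod>i=1..r. [:- b i, 1:] ^ m i"
  have d: "degree ?p = (\<Sum>i=1..r. m i)"
    by (subst degree_prod_eq_sum_degree) (auto simp: degree_linear_power)
  have l: "lead_coeff ?p = 1"
    by (simp add: lead_coeff_prod lead_coeff_power)
  have "degree (backward_heat ?p) = degree ?p"
    using backward_heat_lead[of ?p] l by (intro antisym) (auto intro: le_degree)
  thus "degree (hermite_poly r b m) = (\<Sum>i=1..r. m i)" "lead_coeff (hermite_poly r b m) = 1"
    using d l backward_heat_lead[of ?p] by (auto simp: hermite_poly_def)
qed

lemma prod_linear_factors_split:
  fixes b :: "nat \<Rightarrow> 'a::comm_ring_1"
  assumes "j \<in> {1..r}" "m j > 0"
  shows "(\<Prod>i=1..r. [:- b i, 1:] ^ m i) = [:- b j, 1:] * (\<Prod>i=1..r. [:- b i, 1:] ^ (m(j := m j - 1)) i)"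
proof -
  obtain k where k: "m j = Suc k"
    using assms(2) gr0_conv_Suc by auto
  have "(\<Prod>i\<in>{1..r}-{j}. [:- b i, 1:] ^ m i) = (\<Prod>i\<in>{1..r}-{j}. [:- b i, 1:] ^ (m(j := m j - 1)) i)"
    by (intro prod.cong) auto
  thus ?thesis
    using assms k
    by (subst (1 2) prod.remove[of _ j]) (auto simp: mult_ac simp del: mult_pCons_left mult_pCons_right)
qed

text \<open>This relation and the next one, both read off from the product \<open>\<Prod>(x - b\<^sub>i)\<^bsup>m\<^sub>i\<^esup>\<close> before the heat
  flow is applied, are all that the study of the zeros needs to know about the polynomials.\<close>

lemma hermite_poly_step:
  assumes "j \<in> {1..r}" "m j > 0"
  shows "hermite_poly r b m = hermite_step (b j) (hermite_poly r b (m(j := m j - 1)))"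
  unfolding hermite_poly_def
  by (subst prod_linear_factors_split[of j]) (use assms in \<open>simp_all only: backward_heat_linear_factor\<close>)

lemma pderiv_hermite_poly:
  "pderiv (hermite_poly r b m) = (\<Sum>j=1..r. smult (of_nat (m j)) (hermite_poly r b (m(j := m j - 1))))"
proof -
  have "pderiv (\<Prod>i=1..r. [:- b i, 1:] ^ m i) =
      (\<Sum>j=1..r. smult (of_nat (m j)) (\<Prod>i=1..r. [:- b i, 1:] ^ (m(j := m j - 1)) i))"
    unfolding pderiv_prod
  proof (intro sum.cong refl)
    fix j assume j: "j \<in> {1..r}"
    have "(\<Prod>i\<in>{1..r}-{j}. [:- b i, 1:] ^ m i) = (\<Prod>i\<in>{1..r}-{j}. [:- b i, 1:] ^ (m(j := m j - 1)) i)"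
      by (intro prod.cong) auto
    thus "(\<Prod>i\<in>{1..r}-{j}. [:- b i, 1:] ^ m i) * pderiv ([:- b j, 1:] ^ m j) =
        smult (of_nat (m j)) (\<Prod>i=1..r. [:- b i, 1:] ^ (m(j := m j - 1)) i)"
      using j
      by (cases "m j") (auto simp: prod.remove[of _ j] pderiv_power_Suc pderiv_pCons mult_ac simp
          del: power_Suc)
  qed
  thus ?thesis
    by (simp add: hermite_poly_def pderiv_backward_heat backward_heat_sum backward_heat_smult)
qed

section \<open>Gaussian orthogonality and uniqueness\<close>

definition gauss_functional :: "real \<Rightarrow> real poly \<Rightarrow> real" where
  "gauss_functional b p = (LBINT x. poly p x * exp (b * x) * exp (- x\<^sup>2 / 2))"

lemma gauss_weight_eq: "exp (b * x) * exp (- x\<^sup>2 / 2) =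
    sqrt (2 * pi) * exp (b\<^sup>2 / 2) * normal_density b 1 (x::real)"
  by (simp add: normal_density_def exp_add[symmetric] power2_eq_square algebra_simps
      add_divide_distrib diff_divide_distrib)

lemma integrable_poly_gauss: "integrable lborel (\<lambda>x::real. poly p x * exp (b * x) * exp (- x\<^sup>2 / 2))"
proof -
  define q where "q = p \<circ>\<^sub>p [:b, 1:]"
  have q: "poly p x = (\<Sum>i\<le>degree q. coeff q i * (x - b) ^ i)" for x
    unfolding poly_altdef[symmetric] q_def by (simp add: poly_pcompose)
  have "integrable lborel (\<lambda>x. sqrt (2 * pi) * exp (b\<^sup>2 / 2) * (\<Sum>i\<le>degree q. coeff q i
      * (normal_density b 1 x * (x - b) ^ i)))"
    using integrable_normal_moment[of 1 b] by (intro integrable_mult_right integrable_sum) auto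
  thus ?thesis
    unfolding mult.assoc gauss_weight_eq q
    by (simp add: sum_distrib_left sum_distrib_right mult_ac)
qed

lemma gauss_functional_add: "gauss_functional b (p + q) = gauss_functional b p + gauss_functional b q"
  unfolding gauss_functional_def
  by (subst Bochner_Integration.integral_add[OF integrable_poly_gauss integrable_poly_gauss, symmetric])
     (simp add: distrib_right)

lemma gauss_functional_smult: "gauss_functional b (smult c p) = c * gauss_functional b p"
  unfolding gauss_functional_def by (simp add: mult.assoc)

lemma gauss_functional_diff: "gauss_functional b (p - q) = gauss_functional b p - gauss_functional b q"
  using gauss_functional_add[of b "p - q" q] by simp

lemma gauss_functional_0 [simp]: "gauss_functional b 0 = 0"
  by (simp add: gauss_functional_def)

lemma gauss_functional_const:
  assumes "gauss_functional b [:c:] = 0"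
  shows "c = 0"
proof -
  have "gauss_functional b [:c:] = c * (sqrt (2 * pi) * exp (b\<^sup>2 / 2))"
    unfolding gauss_functional_def mult.assoc gauss_weight_eq by simp
  thus ?thesis using assms by simp
qed

lemma tendsto_poly_gauss:
  "((\<lambda>x::real. poly p x * exp (b * x) * exp (- x\<^sup>2 / 2)) \<longlongrightarrow> 0) at_top"
  "((\<lambda>x::real. poly p x * exp (b * x) * exp (- x\<^sup>2 / 2)) \<longlongrightarrow> 0) at_bot"
proof -
  have top: "((\<lambda>x::real. x ^ k * exp (b * x) * exp (- x\<^sup>2 / 2)) \<longlongrightarrow> 0) at_top" for k b
  proof -
    \<comment> \<open>An extra factor \<open>exp x\<close> is absorbed by the Gaussian and dominates every power.\<close>
    have "((\<lambda>x::real. exp x * exp (b * x) * exp (- x\<^sup>2 / 2)) \<longlongrightarrow> 0) at_top"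
    proof -
      have "filterlim (\<lambda>x::real. (1 + b) * x - x\<^sup>2 / 2) at_bot at_top"
        by real_asymp
      from filterlim_compose[OF exp_at_bot this] show ?thesis
        unfolding exp_add[symmetric] by (simp add: distrib_right)
    qed
    from tendsto_mult[OF tendsto_power_div_exp_0[of k] this]
    have *: "((\<lambda>x::real. x ^ k / exp x * (exp x * exp (b * x) * exp (- x\<^sup>2 / 2))) \<longlongrightarrow> 0) at_top"
      by simp
    have eq: "x ^ k / exp x * (exp x * exp (b * x) * exp (- x\<^sup>2 / 2)) =
        x ^ k * exp (b * x) * exp (- x\<^sup>2 / 2)" for x :: real
      by simp
    show ?thesis
      using * unfolding eq .
  qed
  have "((\<lambda>x::real. x ^ k * exp (b * x) * exp (- x\<^sup>2 / 2)) \<longlongrightarrow> 0) at_bot" for k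
    unfolding filterlim_at_bot_mirror
  proof -
    have eq: "(- x) ^ k * exp (b * - x) * exp (- (- x)\<^sup>2 / 2) =
        (-1) ^ k * (x ^ k * exp (- b * x) * exp (- x\<^sup>2 / 2))" for x :: real
      by (subst power_minus) simp
    show "((\<lambda>x::real. (- x) ^ k * exp (b * - x) * exp (- (- x)\<^sup>2 / 2)) \<longlongrightarrow> 0) at_top"
      unfolding eq by (rule tendsto_mult_right_zero) (rule top)
  qed
  with top have "((\<lambda>x::real. \<Sum>k\<le>degree p. coeff p k * (x ^ k * exp (b * x) * exp (- x\<^sup>2 / 2))) \<longlongrightarrow> 0)
      at_top"
    "((\<lambda>x::real. \<Sum>k\<le>degree p. coeff p k * (x ^ k * exp (b * x) * exp (- x\<^sup>2 / 2))) \<longlongrightarrow> 0) at_bot"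
    by (auto intro!: tendsto_null_sum tendsto_mult_right_zero)
  thus "((\<lambda>x::real. poly p x * exp (b * x) * exp (- x\<^sup>2 / 2)) \<longlongrightarrow> 0) at_top"
    "((\<lambda>x::real. poly p x * exp (b * x) * exp (- x\<^sup>2 / 2)) \<longlongrightarrow> 0) at_bot"
    by (simp_all add: poly_altdef sum_distrib_right mult.assoc)
qed

text \<open>Up to sign, the integrand is the derivative of \<open>p\<close> times the weight, which vanishes at both
  ends of the line.\<close>

lemma gauss_functional_hermite_step: "gauss_functional b (hermite_step b p) = 0"
proof -
  let ?F = "\<lambda>x::real. - (poly p x * exp (b * x) * exp (- x\<^sup>2 / 2))"
  let ?f = "\<lambda>x::real. poly (hermite_step b p) x * exp (b * x) * exp (- x\<^sup>2 / 2)"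
  have "(LBINT x=-\<infinity>..\<infinity>. ?f x) = 0 - 0"
  proof (rule interval_integral_FTC_integrable)
    show "((?F \<circ> real_of_ereal) \<longlongrightarrow> 0) (at_right (-\<infinity>))"
      unfolding ereal_tendsto_simps using tendsto_minus[OF tendsto_poly_gauss(2)[of p b]] by simp
    show "((?F \<circ> real_of_ereal) \<longlongrightarrow> 0) (at_left \<infinity>)"
      unfolding ereal_tendsto_simps using tendsto_minus[OF tendsto_poly_gauss(1)[of p b]] by simp
    show "set_integrable lborel (einterval (-\<infinity>) \<infinity>) ?f"
      using integrable_poly_gauss[of "hermite_step b p" b]
      by (simp add: einterval_def set_integrable_def)
    show "(?F has_vector_derivative ?f x) (at x)" for x
      unfolding has_real_derivative_iff_has_vector_derivative[symmetric] hermite_step_def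
      by (auto intro!: derivative_eq_intros poly_DERIV simp: algebra_simps)
    show "isCont ?f x" for x
      by (intro continuous_intros) auto
  qed auto
  thus ?thesis
    by (simp add: gauss_functional_def interval_lebesgue_integral_def einterval_def
        set_lebesgue_integral_def)
qed

text \<open>Integration by parts: moving the operator off \<open>p\<close> leaves only the derivative of the monomial.
  At \<open>k = 0\<close> the truncated subtraction is harmless because of the factor \<open>k\<close>.\<close>

lemma gauss_functional_monom_hermite_step:
  "gauss_functional b (monom 1 k * hermite_step b p) =
      of_nat k * gauss_functional b (monom 1 (k - 1) * p)"
proof -
  have "monom 1 k * hermite_step b p = hermite_step b (monom 1 k * p) +
      smult (of_nat k) (monom 1 (k - 1) * p)"
  proof -
    have "pderiv (monom 1 k) = smult (of_nat k) (monom (1::real) (k - 1))"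
      by (simp add: pderiv_monom smult_monom)
    thus ?thesis
      by (simp add: hermite_step_def pderiv_mult right_diff_distrib mult_ac del: mult_pCons_left
          mult_pCons_right)
  qed
  thus ?thesis
    by (simp add: gauss_functional_add gauss_functional_smult gauss_functional_hermite_step)
qed

definition gauss_orthogonal :: "real \<Rightarrow> nat \<Rightarrow> real poly \<Rightarrow> bool" where
  "gauss_orthogonal b m p \<longleftrightarrow> (\<forall>k<m. gauss_functional b (monom 1 k * p) = 0)"

lemma gauss_orthogonal_hermite_step_same:
  "gauss_orthogonal b (Suc m) (hermite_step b p) \<longleftrightarrow> gauss_orthogonal b m p"
  by (auto simp: gauss_orthogonal_def gauss_functional_monom_hermite_step less_Suc_eq_0_disj)

text \<open>Induction on the exponent of the test monomial: rewriting \<open>hermite_step b\<close> through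
  \<open>hermite_step c\<close> produces \<open>c - b\<close> times the wanted integral and an integral with a smaller exponent.\<close>

lemma gauss_orthogonal_hermite_step_other:
  assumes "b \<noteq> c" "gauss_orthogonal c m (hermite_step b p)"
  shows "gauss_orthogonal c m p"
proof -
  have "k < m \<Longrightarrow> gauss_functional c (monom 1 k * p) = 0" for k
  proof (induction k rule: less_induct)
    case (less k)
    have "0 = gauss_functional c (monom 1 k * hermite_step b p)"
      using assms(2) less.prems by (auto simp: gauss_orthogonal_def)
    also have "\<dots> = of_nat k * gauss_functional c (monom 1 (k - 1) * p) +
        (c - b) * gauss_functional c (monom 1 k * p)"
      by (subst hermite_step_shift[of b _ c])
         (simp add: gauss_functional_add gauss_functional_smult gauss_functional_monom_hermite_step
             distrib_left)
    also have "of_nat k * gauss_functional c (monom 1 (k - 1) * p) = 0"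
      using less by (cases k) auto
    finally show ?case using assms(1) by simp
  qed
  thus ?thesis by (simp add: gauss_orthogonal_def)
qed

text \<open>The operator raises degrees by one and preserves leading coefficients, so division by it works
  like division by a monic linear polynomial, with a constant remainder.\<close>

lemma hermite_step_division: "\<exists>s c. p = hermite_step b s + [:c:]"
proof (induction "degree p" arbitrary: p rule: less_induct)
  case less
  show ?case
  proof (cases "degree p")
    case 0
    then show ?thesis
      by (metis add_0 degree_eq_zeroE hermite_step_0)
  next
    case (Suc d)
    define t where "t = hermite_step b (monom (lead_coeff p) d)"
    have nz: "lead_coeff p \<noteq> 0" using Suc by (metis degree_0 leading_coeff_0_iff nat.simps(3))
    have "degree t = Suc d"
      using degree_hermite_step[of "monom (lead_coeff p) d" b] nz
      by (simp add: t_def degree_monom_eq monom_eq_0_iff)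
    moreover have "coeff t (Suc d) = lead_coeff p"
      by (simp add: t_def coeff_hermite_step)
    ultimately have "degree (p - t) < degree p"
      using Suc
      by (intro degree_lessI) (auto simp: coeff_eq_0, metis coeff_eq_0 diff_self le_neq_implies_less)
    then obtain s c where "p - t = hermite_step b s + [:c:]" using less by blast
    hence "p = hermite_step b (s + monom (lead_coeff p) d) + [:c:]"
      by (simp add: hermite_step_add t_def algebra_simps)
    thus ?thesis by blast
  qed
qed

lemma gauss_orthogonal_imp_hermite_step:
  assumes "gauss_orthogonal b m p" "m > 0"
  obtains s where "p = hermite_step b s"
proof -
  obtain s c where sc: "p = hermite_step b s + [:c:]" using hermite_step_division by blast
  have "gauss_functional b p = 0" using assms by (auto simp: gauss_orthogonal_def)
  hence "gauss_functional b [:c:] = 0"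
    by (simp add: sc gauss_functional_add gauss_functional_hermite_step)
  hence "c = 0" by (rule gauss_functional_const)
  thus ?thesis using sc that by simp
qed

lemma gauss_orthogonal_hermite_poly:
  assumes "j \<in> {1..r}"
  shows "gauss_orthogonal (b j) (m j) (hermite_poly r b m)"
proof (induction "m j" arbitrary: m)
  case 0
  then show ?case by (simp add: gauss_orthogonal_def)
next
  case (Suc k)
  have "gauss_orthogonal (b j) k (hermite_poly r b (m(j := m j - 1)))"
    using Suc(1)[of "m(j := m j - 1)"] Suc(2)[symmetric] by simp
  thus ?case using assms Suc(2)[symmetric]
    by (simp add: hermite_poly_step[of j r m] gauss_orthogonal_hermite_step_same)
qed

lemma sum_fun_upd_dec:
  fixes m :: "'a \<Rightarrow> nat"
  assumes "finite I" "j \<in> I" "m j > 0"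
  shows "(\<Sum>i\<in>I. m i) = Suc (\<Sum>i\<in>I. (m(j := m j - 1)) i)"
  using assms by (simp add: sum.remove[of _ j])

text \<open>Each orthogonality relation splits off one operator \<open>hermite_step (b j)\<close>, and the remaining
  relations survive because the parameters are distinct. A nonzero \<open>p\<close> would therefore have degree at
  least \<open>\<Sum>m\<^sub>i\<close>.\<close>

lemma gauss_orthogonal_unique:
  fixes r :: nat
  assumes "inj_on b {1..r}" "\<And>j. j \<in> {1..r} \<Longrightarrow> gauss_orthogonal (b j) (m j) p"
    "degree p < (\<Sum>i=1..r. m i)"
  shows "p = 0"
  using assms(2,3)
proof (induction "\<Sum>i=1..r. m i" arbitrary: m p)
  case (Suc d)
  then obtain j where j: "j \<in> {1..r}" "m j > 0"
    by (metis gr0I less_zeroE sum.neutral)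
  let ?m' = "m(j := m j - 1)"
  obtain s where s: "p = hermite_step (b j) s"
    using gauss_orthogonal_imp_hermite_step Suc.prems(1) j by metis
  have d: "d = (\<Sum>i=1..r. ?m' i)" using sum_fun_upd_dec[of "{1..r}" j m] j Suc.hyps(2)
    by (metis finite_atLeastAtMost nat.inject)
  have "gauss_orthogonal (b i) (?m' i) s" if "i \<in> {1..r}" for i
  proof (cases "i = j")
    case True
    thus ?thesis
      using Suc.prems(1)[of j] j s gauss_orthogonal_hermite_step_same[of "b j" "m j - 1" s] by simp
  next
    case False
    hence "b j \<noteq> b i" using inj_on_eq_iff[OF assms(1) j(1) that] by blast
    thus ?thesis
      using False Suc.prems(1)[OF that] gauss_orthogonal_hermite_step_other[of "b j" "b i" "m i" s]
      unfolding s by simp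
  qed
  moreover have "degree s < d" if "s \<noteq> 0"
    using degree_hermite_step[OF that, of "b j"] Suc.prems(2) Suc.hyps(2) s by simp
  ultimately have "s = 0" using Suc.hyps(1)[OF d, of s] d by auto
  thus ?case using s by simp
qed auto

lemma is_multiple_hermite_iff:
  "is_multiple_hermite r b m p \<longleftrightarrow> lead_coeff p = 1 \<and> degree p = (\<Sum>i=1..r. m i) \<and>
     (\<forall>j\<in>{1..r}. gauss_orthogonal (b j) (m j) p)"
  by (simp add: is_multiple_hermite_def gauss_orthogonal_def gauss_functional_def poly_monom)

text \<open>Two candidates are monic of the same degree, so their difference falls under
  \<open>gauss_orthogonal_unique\<close>.\<close>

theorem multiple_hermite_eq:
  assumes "inj_on b {1..r}"
  shows "multiple_hermite r b m = hermite_poly r b m"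
  unfolding multiple_hermite_def
proof (rule the_equality)
  show H: "is_multiple_hermite r b m (hermite_poly r b m)"
    using lead_coeff_hermite_poly[of r b m] degree_hermite_poly[of r b m]
    by (auto simp: is_multiple_hermite_iff gauss_orthogonal_hermite_poly)
  fix p assume p: "is_multiple_hermite r b m p"
  let ?h = "hermite_poly r b m"
  show "p = ?h"
  proof (cases "degree p = 0")
    case True
    then obtain c d where "p = [:c:]" "?h = [:d:]"
      using p H unfolding is_multiple_hermite_iff by (metis degree_eq_zeroE)
    thus ?thesis using p H unfolding is_multiple_hermite_iff by auto
  next
    case False
    have "degree (p - ?h) < degree p"
    proof (rule degree_lessI)
      show "\<forall>k\<ge>degree p. coeff (p - ?h) k = 0"
        using p H
        by (metis (no_types, lifting) coeff_diff coeff_eq_0 diff_self is_multiple_hermite_iff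
            le_neq_implies_less)
    qed (use False in simp)
    moreover have "gauss_orthogonal (b j) (m j) (p - ?h)" if "j \<in> {1..r}" for j
      using p H that unfolding is_multiple_hermite_iff gauss_orthogonal_def
      by (simp add: right_diff_distrib gauss_functional_diff)
    ultimately have "p - ?h = 0"
      using gauss_orthogonal_unique[OF assms, of m "p - ?h"] p by (auto simp: is_multiple_hermite_iff)
    thus ?thesis by simp
  qed
qed

section \<open>Zeros of the rescaled polynomials\<close>

abbreviation cpoly :: "real poly \<Rightarrow> complex poly" where
  "cpoly \<equiv> map_poly complex_of_real"

lemma cpoly_pCons [simp]: "cpoly (pCons c p) = pCons (of_real c) (cpoly p)"
  by (simp add: map_poly_pCons)

lemma cpoly_add: "cpoly (p + q) = cpoly p + cpoly q"
  by (intro poly_eqI) (simp add: coeff_map_poly)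

lemma cpoly_diff: "cpoly (p - q) = cpoly p - cpoly q"
  by (intro poly_eqI) (simp add: coeff_map_poly)

lemma cpoly_smult: "cpoly (smult c p) = smult (of_real c) (cpoly p)"
  by (intro poly_eqI) (simp add: coeff_map_poly)

lemma cpoly_sum: "cpoly (\<Sum>i\<in>I. f i) = (\<Sum>i\<in>I. cpoly (f i))"
  by (induction I rule: infinite_finite_induct) (auto simp: cpoly_add)

lemma cpoly_mult: "cpoly (p * q) = cpoly p * cpoly q"
  by (induction p) (auto simp: cpoly_add cpoly_smult)

lemma cpoly_pderiv: "cpoly (pderiv p) = pderiv (cpoly p)"
  by (intro poly_eqI) (simp add: coeff_map_poly coeff_pderiv)

definition rescaled_hermite :: "nat \<Rightarrow> (nat \<Rightarrow> real) \<Rightarrow> nat \<Rightarrow> (nat \<Rightarrow> nat) \<Rightarrow> real poly" where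
  "rescaled_hermite r a N m = hermite_poly r (\<lambda>j. sqrt (real N) * a j) m \<circ>\<^sub>p [:0, sqrt (real N):]"

text \<open>If \<open>\<Sum>m\<^sub>i = N\<close>, this is the Cauchy transform of the zero distribution. The factor \<open>1/N\<close> is kept for
  shorter multi-indices as well, since the recursion below descends to them with \<open>N\<close> fixed.\<close>

definition zero_stieltjes :: "nat \<Rightarrow> (nat \<Rightarrow> real) \<Rightarrow> nat \<Rightarrow> (nat \<Rightarrow> nat) \<Rightarrow> complex \<Rightarrow> complex" where
  "zero_stieltjes r a N m z = poly (pderiv (cpoly (rescaled_hermite r a N m))) z /
     (of_nat N * poly (cpoly (rescaled_hermite r a N m)) z)"

lemma degree_rescaled_hermite:
  assumes "N > 0"
  shows "degree (rescaled_hermite r a N m) = (\<Sum>i=1..r. m i)"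
  using assms by (simp add: rescaled_hermite_def degree_pcompose degree_hermite_poly)

lemma rescaled_hermite_step:
  assumes "N > 0" "j \<in> {1..r}" "m j > 0"
  shows "rescaled_hermite r a N m =
    smult (sqrt N) ([:- a j, 1:] * rescaled_hermite r a N (m(j := m j - 1)))
    - smult (1 / sqrt N) (pderiv (rescaled_hermite r a N (m(j := m j - 1))))"
  using assms
  by (simp add: rescaled_hermite_def hermite_poly_step[of j r m] hermite_step_def pcompose_diff
      pcompose_mult pderiv_pcompose pcompose_pCons pderiv_pCons pcompose_smult smult_diff_right
          smult_add_right mult_ac)

lemma smult_sum_right: "smult c (\<Sum>i\<in>I. f i) = (\<Sum>i\<in>I. smult c (f i))"
  by (induction I rule: infinite_finite_induct) (auto simp: smult_add_right)

lemma pderiv_rescaled_hermite: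
  "pderiv (rescaled_hermite r a N m) =
     (\<Sum>j=1..r. smult (sqrt N * m j) (rescaled_hermite r a N (m(j := m j - 1))))"
  by (simp add: rescaled_hermite_def pderiv_pcompose pderiv_hermite_poly pcompose_sum pcompose_smult
      pderiv_pCons smult_sum_right mult_ac)

lemma poly_rescaled_hermite_step:
  assumes "N > 0" "j \<in> {1..r}" "m j > 0"
    and "poly (cpoly (rescaled_hermite r a N (m(j := m j - 1)))) z \<noteq> 0"
  shows "poly (cpoly (rescaled_hermite r a N m)) z =
    sqrt N * poly (cpoly (rescaled_hermite r a N (m(j := m j - 1)))) z *
    (z - a j - zero_stieltjes r a N (m(j := m j - 1)) z)"
proof -
  define s :: complex where "s = of_real (sqrt N)"
  have s: "of_nat N = s * s" "s \<noteq> 0"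
    using assms(1) by (auto simp: s_def simp flip: of_real_mult)
  show ?thesis
    using assms(4) s(2)
    by (subst rescaled_hermite_step[where m = m and j = j, OF assms(1-3)])
       (simp add: zero_stieltjes_def s(1) cpoly_diff cpoly_smult cpoly_mult cpoly_pderiv field_simps
           flip: s_def)
qed

text \<open>The derivative is a sum over the shorter multi-indices, and each quotient of neighbouring
  polynomials is given by \<open>poly_rescaled_hermite_step\<close>. Without the shift of the multi-index on the
  right-hand side this would be the equation \<open>w = \<Sum> (m\<^sub>j / N) / (z - a\<^sub>j - w)\<close>, a discrete form of
  \<open>P(z, w) = 0\<close>.\<close>

lemma zero_stieltjes_rec:
  assumes "N > 0" and nz: "poly (cpoly (rescaled_hermite r a N m)) z \<noteq> 0"
    and nz': "\<And>j. j \<in> {1..r} \<Longrightarrow> m j > 0 \<Longrightarrow> poly (cpoly (rescaled_hermite r a N (m(j := m j - 1)))) z \<noteq> 0"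
  shows "zero_stieltjes r a N m z =
    (\<Sum>j=1..r. of_real (m j / N) * (1 / (z - a j - zero_stieltjes r a N (m(j := m j - 1)) z)))"
proof -
  have "zero_stieltjes r a N m z =
      (\<Sum>j=1..r. sqrt N * m j * poly (cpoly (rescaled_hermite r a N (m(j := m j - 1)))) z
      / (of_nat N * poly (cpoly (rescaled_hermite r a N m)) z))"
    by (simp add: zero_stieltjes_def pderiv_rescaled_hermite cpoly_sum cpoly_smult poly_sum
        sum_divide_distrib
        flip: cpoly_pderiv)
  also have "\<dots> =
      (\<Sum>j=1..r. of_real (m j / N) * (1 / (z - a j - zero_stieltjes r a N (m(j := m j - 1)) z)))"
  proof (intro sum.cong refl)
    fix j assume j: "j \<in> {1..r}"
    show "sqrt N * m j * poly (cpoly (rescaled_hermite r a N (m(j := m j - 1)))) z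
      / (of_nat N * poly (cpoly (rescaled_hermite r a N m)) z) =
      of_real (m j / N) * (1 / (z - a j - zero_stieltjes r a N (m(j := m j - 1)) z))"
    proof (cases "m j = 0")
      case False
      hence p: "m j > 0" by simp
      have "complex_of_real (sqrt N) \<noteq> 0" using assms(1) by simp
      thus ?thesis
        using nz nz'[OF j p] poly_rescaled_hermite_step[where a=a and z=z, OF assms(1) j p nz'[OF j p]]
        by (simp add: divide_simps)
    qed simp
  qed
  finally show ?thesis .
qed

lemma convex_sum_le_1:
  fixes W :: "'a::real_vector set"
  assumes "convex W" "0 \<in> W" "finite I" "\<And>i. i \<in> I \<Longrightarrow> t i \<ge> 0" "(\<Sum>i\<in>I. t i) \<le> 1"
    "\<And>i. i \<in> I \<Longrightarrow> u i \<in> W"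
  shows "(\<Sum>i\<in>I. t i *\<^sub>R u i) \<in> W"
proof (cases "(\<Sum>i\<in>I. t i) = 0")
  case True
  hence "\<forall>i\<in>I. t i = 0" using assms(3,4) by (simp add: sum_nonneg_eq_0_iff)
  thus ?thesis using assms(2) by simp
next
  case False
  define T where "T = (\<Sum>i\<in>I. t i)"
  have T: "T > 0" "T \<le> 1"
    using False assms(4,5) sum_nonneg[of I t] by (auto simp: T_def)
  have "(\<Sum>i\<in>I. (t i / T) *\<^sub>R u i) \<in> W"
    using assms(1,3,4,6) T by (intro convex_sum) (auto simp: T_def simp flip: sum_divide_distrib)
  hence "(1 - T) *\<^sub>R 0 + T *\<^sub>R (\<Sum>i\<in>I. (t i / T) *\<^sub>R u i) \<in> W"
    using assms(1,2) T by (intro convexD) auto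
  also have "(1 - T) *\<^sub>R 0 + T *\<^sub>R (\<Sum>i\<in>I. (t i / T) *\<^sub>R u i) = (\<Sum>i\<in>I. t i *\<^sub>R u i)"
    using T by (simp add: scaleR_sum_right)
  finally show ?thesis .
qed

lemma sum_weights_le_1:
  fixes m :: "'a \<Rightarrow> nat"
  assumes "(\<Sum>i\<in>I. m i) \<le> N"
  shows "(\<Sum>i\<in>I. real (m i) / real N) \<le> 1"
  using assms by (cases "N = 0") (auto simp: divide_le_eq_1 simp flip: sum_divide_distrib of_nat_sum)

text \<open>By the recursion, \<open>zero_stieltjes\<close> is a combination of values of the maps \<open>w \<mapsto> 1 / (z - a\<^sub>j - w)\<close>
  with weights \<open>m\<^sub>j / N\<close>; the mass missing from a convex combination sits at \<open>0\<close>. So every convex set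
  that contains \<open>0\<close> and is invariant under these maps captures all values, and the same induction keeps
  the polynomials from vanishing at \<open>z\<close>. The two lemmas that follow choose discs and half planes.\<close>

lemma rescaled_hermite_invariant:
  assumes N: "N > 0" and W: "convex W" "0 \<in> W"
    and inv: "\<And>j w. j \<in> {1..r} \<Longrightarrow> w \<in> W \<Longrightarrow> z - of_real (a j) - w \<noteq> 0 \<and> 1 / (z - of_real (a j) - w) \<in> W"
    and m: "(\<Sum>i=1..r. m i) \<le> N"
  shows "poly (cpoly (rescaled_hermite r a N m)) z \<noteq> 0 \<and> zero_stieltjes r a N m z \<in> W"
  using m
proof (induction "\<Sum>i=1..r. m i" arbitrary: m rule: less_induct)
  case less
  let ?Q = "\<lambda>m. poly (cpoly (rescaled_hermite r a N m)) z"
  have IH: "?Q (m(j := m j - 1)) \<noteq> 0 \<and> zero_stieltjes r a N (m(j := m j - 1)) z \<in> W"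
    if "j \<in> {1..r}" "m j > 0" for j
    using less.hyps[of "m(j := m j - 1)"] less.prems sum_fun_upd_dec[of "{1..r}" j m] that by simp
  have nz: "?Q m \<noteq> 0"
  proof (cases "\<exists>j\<in>{1..r}. m j > 0")
    case True
    then obtain j where j: "j \<in> {1..r}" "m j > 0" by blast
    show ?thesis
      using poly_rescaled_hermite_step[OF N j conjunct1[OF IH[OF j]]] IH[OF j] inv[OF j(1)] N by simp
  next
    case False
    hence "degree (cpoly (rescaled_hermite r a N m)) = 0"
      using N by (simp add: degree_map_poly degree_rescaled_hermite)
    moreover have "rescaled_hermite r a N m \<noteq> 0"
      using lead_coeff_hermite_poly[of r "\<lambda>j. sqrt N * a j" m] N
      by (auto simp: rescaled_hermite_def pcompose_eq_0_iff)
    hence "cpoly (rescaled_hermite r a N m) \<noteq> 0"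
      by (simp add: map_poly_eq_0_iff)
    ultimately show ?thesis
      by (auto elim!: degree_eq_zeroE)
  qed
  have "(\<Sum>j=1..r. (real (m j) / N) *\<^sub>R (if m j > 0 then 1 / (z - a j - zero_stieltjes r a N
      (m(j := m j - 1)) z) else 0)) \<in> W"
    using W inv IH sum_weights_le_1[OF less.prems] by (intro convex_sum_le_1) auto
  also have "(\<Sum>j=1..r. (real (m j) / N) *\<^sub>R (if m j > 0 then 1 / (z - a j - zero_stieltjes r a N
      (m(j := m j - 1)) z) else 0))
      = zero_stieltjes r a N m z"
    using zero_stieltjes_rec[OF N nz] IH by (auto simp: scaleR_conv_of_real intro!: sum.cong)
  finally show ?case using nz by blast
qed

text \<open>For such \<open>z\<close> the closed unit disc is invariant. Hence all zeros lie in a disc that does not depend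
  on \<open>N\<close>.\<close>

lemma zero_stieltjes_outside:
  assumes "N > 0" and A: "\<And>j. j \<in> {1..r} \<Longrightarrow> \<bar>a j\<bar> \<le> A" and "cmod z \<ge> A + 2" "(\<Sum>i=1..r. m i) \<le> N"
  shows "poly (cpoly (rescaled_hermite r a N m)) z \<noteq> 0" "cmod (zero_stieltjes r a N m z) \<le> 1"
proof -
  have "poly (cpoly (rescaled_hermite r a N m)) z \<noteq> 0 \<and> zero_stieltjes r a N m z \<in> cball 0 1"
  proof (rule rescaled_hermite_invariant)
    fix j w assume j: "j \<in> {1..r}" and w: "w \<in> cball (0::complex) 1"
    have "cmod (z - of_real (a j) - w) \<ge> cmod z - \<bar>a j\<bar> - cmod w"
      by (smt (verit) norm_of_real norm_triangle_ineq2)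
    hence "cmod (z - of_real (a j) - w) \<ge> 1"
      using A[OF j] w assms(3) by simp
    thus "z - of_real (a j) - w \<noteq> 0 \<and> 1 / (z - of_real (a j) - w) \<in> cball 0 1"
      by (auto simp: norm_divide divide_simps)
  qed (use assms in auto)
  thus "poly (cpoly (rescaled_hermite r a N m)) z \<noteq> 0" "cmod (zero_stieltjes r a N m z) \<le> 1"
    by auto
qed

text \<open>The closed half plane on the other side of the real axis from \<open>z\<close> is invariant. Hence all zeros
  are real.\<close>

lemma rescaled_hermite_nonreal:
  assumes "N > 0" "Im z \<noteq> 0" "(\<Sum>i=1..r. m i) \<le> N"
  shows "poly (cpoly (rescaled_hermite r a N m)) z \<noteq> 0"
proof -
  \<comment> \<open>The sign treats the upper and the lower half plane at once.\<close>
  define \<sigma> where "\<sigma> = sgn (Im z)"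
  have \<sigma>: "\<sigma> * Im z > 0" using assms(2) by (simp add: \<sigma>_def sgn_if)
  have "poly (cpoly (rescaled_hermite r a N m)) z \<noteq> 0 \<and>
      zero_stieltjes r a N m z \<in> {w. (\<i> * of_real \<sigma>) \<bullet> w \<le> 0}"
  proof (rule rescaled_hermite_invariant)
    fix j w assume w: "w \<in> {w. (\<i> * of_real \<sigma>) \<bullet> w \<le> 0}"
    let ?u = "z - of_real (a j) - w"
    have pos: "\<sigma> * Im ?u > 0" using w \<sigma> by (simp add: inner_complex_def right_diff_distrib)
    hence "Im ?u \<noteq> 0" by auto
    moreover have "\<sigma> * Im (1 / ?u) = - (\<sigma> * Im ?u) / (cmod ?u)\<^sup>2"
      by (simp add: Im_divide cmod_def right_diff_distrib diff_divide_distrib)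
    hence "\<sigma> * Im (1 / ?u) \<le> 0" using pos by (simp add: divide_nonpos_nonneg)
    ultimately show "?u \<noteq> 0 \<and> 1 / ?u \<in> {w. (\<i> * of_real \<sigma>) \<bullet> w \<le> 0}"
      by (auto simp: inner_complex_def)
  qed (use assms in \<open>auto simp: convex_halfspace_le\<close>)
  thus ?thesis by blast
qed

text \<open>One unit further out than the invariance of the disc requires, the denominators have modulus at
  least \<open>2\<close>, and the maps become contractions with constant \<open>1/4\<close>.\<close>

lemma inverse_lipschitz:
  fixes z w w' :: complex
  assumes "\<bar>a\<bar> \<le> A" "cmod z \<ge> A + 3" "cmod w \<le> 1" "cmod w' \<le> 1"
  shows "cmod (1 / (z - of_real a - w)) \<le> 1 / 2"
    and "cmod (1 / (z - of_real a - w) - 1 / (z - of_real a - w')) \<le> cmod (w - w') / 4"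
proof -
  have *: "cmod (z - of_real a - v) \<ge> 2" if "cmod v \<le> 1" for v
  proof -
    have "cmod (z - of_real a - v) \<ge> cmod z - \<bar>a\<bar> - cmod v"
      by (smt (verit) norm_of_real norm_triangle_ineq2)
    thus ?thesis using assms(1,2) that by simp
  qed
  define u u' where "u = z - of_real a - w" and "u' = z - of_real a - w'"
  have u: "cmod u \<ge> 2" "cmod u' \<ge> 2" using * assms by (auto simp: u_def u'_def)
  hence nz: "u \<noteq> 0" "u' \<noteq> 0" by auto
  have "cmod (1 / u) \<le> 1 / 2"
    using u by (simp add: norm_divide divide_simps)
  thus "cmod (1 / (z - of_real a - w)) \<le> 1 / 2" by (simp add: u_def)
  have "1 / u - 1 / u' = (w - w') / (u * u')"
    using nz by (simp add: field_simps) (simp add: u_def u'_def)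
  moreover have "cmod u * cmod u' \<ge> 2 * 2" using u by (intro mult_mono) auto
  ultimately have "cmod (1 / u - 1 / u') \<le> cmod (w - w') / 4"
    using divide_left_mono[of 4 "cmod u * cmod u'" "cmod (w - w')"] nz
    by (simp add: norm_divide norm_mult zero_less_mult_iff)
  thus "cmod (1 / (z - of_real a - w) - 1 / (z - of_real a - w')) \<le> cmod (w - w') / 4"
    by (simp add: u_def u'_def)
qed

lemma norm_sum_weights_le:
  fixes v :: "'a \<Rightarrow> complex"
  assumes "\<And>i. i \<in> I \<Longrightarrow> t i \<ge> 0" "(\<Sum>i\<in>I. t i) \<le> 1" "\<And>i. i \<in> I \<Longrightarrow> t i > 0 \<Longrightarrow> cmod (v i) \<le> c" "c \<ge> 0"
  shows "cmod (\<Sum>i\<in>I. of_real (t i) * v i) \<le> c"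
proof -
  have "cmod (\<Sum>i\<in>I. of_real (t i) * v i) \<le> (\<Sum>i\<in>I. t i * c)"
  proof (rule sum_norm_le)
    fix i assume "i \<in> I"
    thus "cmod (of_real (t i) * v i) \<le> t i * c"
      using assms(1,3)[of i] by (cases "t i = 0") (auto simp: norm_mult intro!: mult_left_mono)
  qed
  also have "\<dots> = (\<Sum>i\<in>I. t i) * c" by (simp add: sum_distrib_right)
  also have "\<dots> \<le> 1 * c" using assms(2,4) by (intro mult_right_mono)
  finally show ?thesis by simp
qed

text \<open>Both terms obey the recursion, with weights that differ only at \<open>j\<close>, by \<open>1/N\<close>. By induction and
  contraction the common weights contribute at most \<open>1/(4N)\<close>, and the extra one at most \<open>1/(2N)\<close>.\<close>

lemma zero_stieltjes_dec:
  assumes N: "N > 0" and A: "\<And>j. j \<in> {1..r} \<Longrightarrow> \<bar>a j\<bar> \<le> A" and z: "cmod z \<ge> A + 3"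
    and "(\<Sum>i=1..r. m i) \<le> N" "j \<in> {1..r}" "m j > 0"
  shows "cmod (zero_stieltjes r a N m z - zero_stieltjes r a N (m(j := m j - 1)) z) \<le> 1 / N"
  using assms(4-6)
proof (induction "\<Sum>i=1..r. m i" arbitrary: m rule: less_induct)
  case less
  let ?G = "\<lambda>m. zero_stieltjes r a N m z"
  let ?m' = "m(j := m j - 1)"
  let ?u = "\<lambda>m i. 1 / (z - a i - ?G (m(i := m i - 1)))"
  have le': "(\<Sum>l=1..r. (k(i := k i - 1)) l) \<le> (\<Sum>l=1..r. k l)" for k :: "nat \<Rightarrow> nat" and i
    by (intro sum_mono) auto
  have z2: "cmod z \<ge> A + 2" using z by simp
  note nz = zero_stieltjes_outside(1)[OF N A z2] and bd = zero_stieltjes_outside(2)[OF N A z2]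
  have rec: "?G k = (\<Sum>i=1..r. of_real (k i / N) * ?u k i)" if "(\<Sum>i=1..r. k i) \<le> N" for k
    using that le'[of k] by (intro zero_stieltjes_rec N nz order.trans[OF le' that]) auto
  have m': "(\<Sum>i=1..r. ?m' i) \<le> N" using le'[of m j] less.prems(1) by linarith
  have "?G m = (\<Sum>i=1..r. of_real (?m' i / N) * ?u m i +
      of_real ((if i = j then 1 else 0) / N) * ?u m i)"
    unfolding rec[OF less.prems(1)] using less.prems(3)
    by (intro sum.cong) (auto simp: of_nat_diff field_simps add_divide_distrib diff_divide_distrib)
  also have "\<dots> = (\<Sum>i=1..r. of_real (?m' i / N) * ?u m i) + of_real (1 / N) * ?u m j"
    using less.prems(2)
    by (simp add: sum.distrib if_distrib[of "\<lambda>x. x / _"] if_distrib[of of_real] if_distrib[of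
        "\<lambda>x. x * _"] sum.delta' cong: if_cong)
  finally have "?G m - ?G ?m' = (\<Sum>i=1..r. of_real (?m' i / N) * (?u m i - ?u ?m' i)) +
      of_real (1 / N) * ?u m j"
    unfolding rec[OF m'] by (simp add: right_diff_distrib sum_subtractf)
  moreover have "cmod (\<Sum>i=1..r. of_real (?m' i / N) * (?u m i - ?u ?m' i)) \<le> 1 / N / 4"
  proof (rule norm_sum_weights_le)
    fix i assume i: "i \<in> {1..r}" and "0 < real (?m' i) / N"
    hence pos: "?m' i > 0" by (auto simp: zero_less_divide_iff)
    hence pos': "m i > 0" by (auto split: if_splits)
    have "cmod (?G (m(i := m i - 1)) - ?G ((m(i := m i - 1))(j := (m(i := m i - 1)) j - 1))) \<le> 1 / N"
      using less.hyps[of "m(i := m i - 1)"] less.prems sum_fun_upd_dec[of "{1..r}" i m] i pos pos'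
      by (auto split: if_splits)
    also have "(m(i := m i - 1))(j := (m(i := m i - 1)) j - 1) = ?m'(i := ?m' i - 1)"
      by (auto simp: fun_eq_iff)
    finally have d: "cmod (?G (m(i := m i - 1)) - ?G (?m'(i := ?m' i - 1))) \<le> 1 / N" .
    have "cmod (?u m i - ?u ?m' i) \<le> cmod (?G (m(i := m i - 1)) - ?G (?m'(i := ?m' i - 1))) / 4"
      using i le'[of m i] le'[of ?m' i] m' less.prems(1)
      by (intro inverse_lipschitz(2)[OF A z] bd) (auto intro: order.trans)
    also have "\<dots> \<le> 1 / N / 4" by (rule divide_right_mono[OF d]) simp
    finally show "cmod (?u m i - ?u ?m' i) \<le> 1 / N / 4" .
  qed (use sum_weights_le_1[OF m'] in auto)
  moreover have "cmod (of_real (1 / N) * ?u m j) \<le> 1 / N * (1 / 2)"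
  proof -
    have "cmod (?u m j) \<le> 1 / 2"
      using le'[of m j] less.prems by (intro inverse_lipschitz(1)[OF A z, where w' = 0] bd) auto
    thus ?thesis unfolding norm_mult using N by (intro mult_mono) (auto simp: norm_divide)
  qed
  ultimately have "cmod (?G m - ?G ?m') \<le> 1 / N / 4 + 1 / N * (1 / 2)"
    by (simp only: norm_triangle_mono)
  also have "\<dots> \<le> 1 / N" using N by (simp add: field_simps)
  finally show ?case .
qed

text \<open>In the recursion, replacing the shorter multi-indices by \<open>m\<close> costs at most \<open>1/N\<close> by the previous
  lemma, and replacing \<open>m\<^sub>j / N\<close> by \<open>q\<^sub>j\<close> costs at most the difference.\<close>

lemma zero_stieltjes_approx:
  assumes N: "N > 0" and A: "\<And>j. j \<in> {1..r} \<Longrightarrow> \<bar>a j\<bar> \<le> A" and z: "cmod z \<ge> A + 3"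
    and m: "(\<Sum>i=1..r. m i) \<le> N"
  shows "cmod (zero_stieltjes r a N m z -
      (\<Sum>j=1..r. of_real (q j) * (1 / (z - a j - zero_stieltjes r a N m z)))) \<le>
      1 / N + (\<Sum>j=1..r. \<bar>m j / N - q j\<bar>)"
proof -
  let ?G = "\<lambda>m. zero_stieltjes r a N m z"
  let ?v = "\<lambda>j. 1 / (z - a j - ?G m)" and ?u = "\<lambda>i. 1 / (z - a i - ?G (m(i := m i - 1)))"
  have z2: "cmod z \<ge> A + 2" using z by simp
  note nz = zero_stieltjes_outside(1)[OF N A z2] and bd = zero_stieltjes_outside(2)[OF N A z2]
  have le': "(\<Sum>l=1..r. (m(i := m i - 1)) l) \<le> N" for i
    by (rule order.trans[OF _ m]) (intro sum_mono, auto)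
  have rec: "?G m = (\<Sum>i=1..r. of_real (m i / N) * ?u i)"
    by (intro zero_stieltjes_rec N nz le' m)
  have lin: "(\<Sum>i\<in>I. of_real (t i) * x i) - (\<Sum>i\<in>I. of_real (q i) * y i) =
      (\<Sum>i\<in>I. of_real (t i) * (x i - y i)) + (\<Sum>i\<in>I. of_real (t i - q i) * y i)"
    for t and x y :: "nat \<Rightarrow> complex" and I
    unfolding sum.distrib[symmetric] sum_subtractf[symmetric]
    by (intro sum.cong) (auto simp: algebra_simps)
  have "?G m - (\<Sum>j=1..r. of_real (q j) * ?v j) =
      (\<Sum>i=1..r. of_real (m i / N) * ?u i) - (\<Sum>j=1..r. of_real (q j) * ?v j)"
    by (rule arg_cong[OF rec])
  also have "\<dots> = (\<Sum>i=1..r. of_real (m i / N) * (?u i - ?v i)) +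
      (\<Sum>i=1..r. of_real (m i / N - q i) * ?v i)"
    by (rule lin)
  finally have "?G m - (\<Sum>j=1..r. of_real (q j) * ?v j) =
      (\<Sum>i=1..r. of_real (m i / N) * (?u i - ?v i)) + (\<Sum>i=1..r. of_real (m i / N - q i) * ?v i)" .
  moreover have "cmod (\<Sum>i=1..r. of_real (m i / N) * (?u i - ?v i)) \<le> 1 / N"
  proof (rule norm_sum_weights_le)
    fix i assume i: "i \<in> {1..r}" and "0 < real (m i) / N"
    hence pos: "m i > 0" by (auto simp: zero_less_divide_iff)
    have "cmod (?G m - ?G (m(i := m i - 1))) \<le> 1 / N"
      by (rule zero_stieltjes_dec[where a = a and j = i, OF N A z m i pos])
    hence le: "cmod (?G (m(i := m i - 1)) - ?G m) \<le> 1 / N"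
      by (subst norm_minus_commute)
    have "cmod (?u i - ?v i) \<le> cmod (?G (m(i := m i - 1)) - ?G m) / 4"
      using i by (intro inverse_lipschitz(2)[OF A z] bd le' m) auto
    also have "\<dots> \<le> cmod (?G (m(i := m i - 1)) - ?G m) / 1"
      by (rule divide_left_mono) auto
    finally show "cmod (?u i - ?v i) \<le> 1 / N"
      using le by simp
  qed (use sum_weights_le_1[OF m] in auto)
  moreover have "cmod (\<Sum>i=1..r. of_real (m i / N - q i) * ?v i) \<le> (\<Sum>i=1..r. \<bar>m i / N - q i\<bar>)"
  proof (rule sum_norm_le)
    fix i assume i: "i \<in> {1..r}"
    have "cmod (?v i) \<le> 1"
      using inverse_lipschitz(1)[OF A z, of i "?G m" 0] i bd[OF _ m] by simp
    thus "cmod (of_real (m i / N - q i) * ?v i) \<le> \<bar>m i / N - q i\<bar>"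
      unfolding norm_mult norm_of_real by (rule mult_left_le) simp
  qed
  ultimately show ?thesis
    by (simp only: norm_triangle_mono)
qed

section \<open>Supports, moments and the R-transform\<close>

lemma closed_measure_support: "closed (measure_support M)"
proof -
  have "- measure_support M = \<Union>{U. open U \<and> emeasure M U = 0}"
    by (auto simp: measure_support_def zero_less_iff_neq_zero)
  thus ?thesis by (auto simp: closed_def)
qed

text \<open>The complement of the support is a union of open null sets, and countably many of them suffice by
  the Lindelof property.\<close>

lemma AE_in_measure_support:
  fixes M :: "'a::second_countable_topology measure"
  assumes "sets M = sets borel"
  shows "AE x in M. x \<in> measure_support M"
proof -
  obtain F where F: "F \<subseteq> {U. open U \<and> emeasure M U = 0}" "countable F" "\<Union>F = \<Union>{U. open U \<and>
      emeasure M U = 0}"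
    using Lindelof[of "{U. open U \<and> emeasure M U = 0}"] by auto
  have "\<Union>F \<in> null_sets M"
    using F(1,2) assms by (intro null_sets_UN'[of F "\<lambda>x. x", simplified]) (auto simp: null_sets_def)
  moreover have "- measure_support M = \<Union>F"
    unfolding F(3) by (auto simp: measure_support_def zero_less_iff_neq_zero)
  ultimately show ?thesis
    by (auto intro!: AE_I'[of "\<Union>F"])
qed

lemma measure_support_subset:
  assumes "sets M = sets borel" "closed S" "AE x in M. x \<in> S"
  shows "measure_support M \<subseteq> S"
proof
  fix x assume x: "x \<in> measure_support M"
  have "emeasure M (- S) = 0"
    using assms by (subst (asm) AE_iff_measurable[where N = "- S"]) (auto simp: sets_eq_imp_space_eq)
  thus "x \<in> S"
    using x assms(2) by (auto simp: measure_support_def open_Compl dest!: spec[of _ "- S"])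
qed

lemma compactly_supported_prob_iff:
  "compactly_supported_prob M \<longleftrightarrow> real_distribution M \<and> (\<exists>B. AE x in M. \<bar>x\<bar> \<le> B)"
proof (intro iffI conjI; (elim conjE exE)?)
  assume M: "compactly_supported_prob M"
  then show "real_distribution M" by (simp add: compactly_supported_prob_def)
  then interpret real_distribution M .
  have "bounded (measure_support M)"
    using M by (auto simp: compactly_supported_prob_def compact_imp_bounded)
  then obtain B where "\<forall>x\<in>measure_support M. \<bar>x\<bar> \<le> B"
    by (auto simp: bounded_iff)
  thus "\<exists>B. AE x in M. \<bar>x\<bar> \<le> B"
    using AE_in_measure_support[OF events_eq_borel] by (intro exI[of _ B]) (auto elim: eventually_mono)
next
  fix B assume M: "real_distribution M" "AE x in M. \<bar>x\<bar> \<le> B"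
  then interpret real_distribution M by simp
  have "AE x in M. x \<in> {-B..B}" using M(2) by (auto elim: eventually_mono)
  hence "measure_support M \<subseteq> {-B..B}"
    by (intro measure_support_subset) auto
  thus "compactly_supported_prob M"
    using M(1) closed_measure_support[of M] bounded_subset[OF bounded_closed_interval]
    by (auto simp: compactly_supported_prob_def compact_eq_bounded_closed)
qed

lemma (in prob_space) bounded_sums_integral:
  fixes f :: "nat \<Rightarrow> 'a \<Rightarrow> 'b::{banach, second_countable_topology}"
  assumes [measurable]: "\<And>i. f i \<in> borel_measurable M" "s \<in> borel_measurable M"
    and bound: "AE x in M. \<forall>i. norm (f i x) \<le> c i" and c: "summable c"
    and sums: "AE x in M. (\<lambda>i. f i x) sums s x"
  shows "(\<lambda>i. \<integral>x. f i x \<partial>M) sums (\<integral>x. s x \<partial>M)"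
proof -
  have b: "AE x in M. norm (f i x) \<le> c i" for i
    using bound by (auto elim: eventually_mono)
  have int: "integrable M (f i)" for i
    using b by (intro integrable_const_bound) auto
  have "(\<lambda>i. \<integral>x. f i x \<partial>M) sums (\<integral>x. (\<Sum>i. f i x) \<partial>M)"
  proof (rule sums_integral[OF int])
    show "AE x in M. summable (\<lambda>i. norm (f i x))"
      using bound by eventually_elim (auto intro!: summable_comparison_test[OF _ c])
    have "(\<integral>x. norm (f i x) \<partial>M) \<le> c i" for i
      using integral_mono_AE[of M "\<lambda>x. norm (f i x)" "\<lambda>_. c i"] b[of i] int[of i]
      by (simp add: prob_space)
    thus "summable (\<lambda>i. \<integral>x. norm (f i x) \<partial>M)"
      by (intro summable_comparison_test[OF _ c]) (auto intro!: exI[of _ 0] integral_nonneg_AE)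
  qed
  also have "(\<integral>x. (\<Sum>i. f i x) \<partial>M) = (\<integral>x. s x \<partial>M)"
    using sums by (intro integral_cong_AE) (auto elim!: eventually_mono simp: sums_iff)
  finally show ?thesis .
qed

text \<open>A bounded variable has an exponential series that may be integrated term by term, so the
  moments determine the characteristic function.\<close>

lemma moments_determine:
  assumes M: "real_distribution M" "AE x in M. \<bar>x\<bar> \<le> B"
    and M': "real_distribution M'" "AE x in M'. \<bar>x\<bar> \<le> B'"
    and eq: "\<And>k. (\<integral>x. x ^ k \<partial>M) = (\<integral>x. x ^ k \<partial>M')"
  shows "M = M'"
proof (rule Levy_uniqueness[OF M(1) M'(1)], rule ext)
  fix t :: real
  have *: "(\<lambda>k. (\<i> * of_real t) ^ k / fact k * of_real (\<integral>x. x ^ k \<partial>L)) sums char L t"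
    if L: "real_distribution L" "AE x in L. \<bar>x\<bar> \<le> D" for L :: "real measure" and D
  proof -
    interpret L: real_distribution L by fact
    have "(\<lambda>k. \<integral>x. (\<i> * of_real t) ^ k / fact k * of_real (x ^ k) \<partial>L) sums (\<integral>x. iexp (t * x) \<partial>L)"
    proof (rule L.bounded_sums_integral)
      show "AE x in L. \<forall>k. norm ((\<i> * of_real t) ^ k / fact k * complex_of_real (x ^ k)) \<le>
          (\<bar>t\<bar> * D) ^ k / fact k"
        using L(2)
      proof eventually_elim
        case (elim x)
        have "norm ((\<i> * of_real t) ^ k / fact k * complex_of_real (x ^ k)) =
            (\<bar>t\<bar> * \<bar>x\<bar>) ^ k / fact k" for k
          by (simp add: norm_mult norm_divide norm_power power_mult_distrib)
        moreover have "(\<bar>t\<bar> * \<bar>x\<bar>) ^ k / fact k \<le> (\<bar>t\<bar> * D) ^ k / fact k" for k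
          using elim by (intro divide_right_mono power_mono mult_left_mono) auto
        ultimately show ?case by simp
      qed
      show "summable (\<lambda>k. (\<bar>t\<bar> * D) ^ k / fact k)"
        using summable_exp_generic[of "\<bar>t\<bar> * D"] by (simp add: divide_inverse_commute)
      have "(\<lambda>k. (\<i> * of_real t) ^ k / fact k * complex_of_real (x ^ k)) sums iexp (t * x)" for x
        using exp_converges[of "\<i> * complex_of_real (t * x)"]
        by (simp add: power_mult_distrib scaleR_conv_of_real field_simps)
      thus "AE x in L. (\<lambda>k. (\<i> * of_real t) ^ k / fact k * complex_of_real (x ^ k)) sums iexp (t * x)"
        by simp
    qed auto
    thus ?thesis by (simp add: char_def del: of_real_power)
  qed
  show "char M t = char M' t"
    using sums_unique2[OF *[OF M]] *[OF M'] by (simp add: eq)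
qed

lemma cauchy_series_nth_0 [simp]: "fps_nth (cauchy_series M) 0 = 0"
  and cauchy_series_nth_Suc [simp]: "fps_nth (cauchy_series M) (Suc k) = (\<integral>x. x ^ k \<partial>M)"
  by (simp_all add: cauchy_series_def)

lemma cauchy_series_nth_1:
  assumes "real_distribution M"
  shows "fps_nth (cauchy_series M) 1 = 1"
proof -
  interpret real_distribution M by fact
  show ?thesis using prob_space by (simp add: One_nat_def del: One_nat_def[symmetric])
qed

text \<open>Every step from the moments to the R-transform is injective.\<close>

lemma R_transform_determines:
  assumes M: "compactly_supported_prob M" and M': "compactly_supported_prob M'"
    and eq: "R_transform M = R_transform M'"
  shows "M = M'"
proof -
  obtain B B' where B: "real_distribution M" "AE x in M. \<bar>x\<bar> \<le>
      B" "real_distribution M'" "AE x in M'. \<bar>x\<bar> \<le> B'"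
    using M M' unfolding compactly_supported_prob_iff by blast
  have "inverse (K_series M) = inverse (K_series M')"
    using eq by (simp add: R_transform_def)
  hence "fps_inv (cauchy_series M) = fps_inv (cauchy_series M')"
    by (simp add: K_series_def)
  hence "cauchy_series M = cauchy_series M'"
    using B fps_inv_idempotent[of "cauchy_series M"] fps_inv_idempotent[of "cauchy_series M'"]
    by (metis cauchy_series_nth_0 cauchy_series_nth_1 zero_neq_one)
  hence "(\<integral>x. x ^ k \<partial>M) = (\<integral>x. x ^ k \<partial>M')" for k
    by (metis cauchy_series_nth_Suc)
  thus ?thesis using moments_determine[OF B] by blast
qed

lemma has_fps_expansion_cauchy_series:
  assumes M: "real_distribution M" "AE x in M. \<bar>x\<bar> \<le> B"
  shows "(\<lambda>u. \<integral>x. u / (1 - u * x) \<partial>M) has_fps_expansion cauchy_series M"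
proof (rule has_fps_expansionI)
  interpret real_distribution M by fact
  \<comment> \<open>A positive bound, so that the radius \<open>1 / C\<close> makes sense.\<close>
  define C where "C = max B 1"
  have C: "AE x in M. \<bar>x\<bar> \<le> C" "C > 0" using M(2) by (auto simp: C_def elim: eventually_mono)
  have sums: "(\<lambda>k. fps_nth (cauchy_series M) k * u ^ k) sums (\<integral>x. u / (1 - u * x) \<partial>M)"
      if u: "\<bar>u\<bar> < 1 / C" for u
  proof -
    have uC: "\<bar>u\<bar> * C < 1" using u C(2) by (simp add: field_simps)
    have "(\<lambda>k. \<integral>x. u * (u * x) ^ k \<partial>M) sums (\<integral>x. u / (1 - u * x) \<partial>M)"
    proof (rule bounded_sums_integral)
      have b: "AE x in M. \<bar>u * x\<bar> \<le> \<bar>u\<bar> * C"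
        using C(1) by eventually_elim (auto simp: abs_mult intro: mult_left_mono)
      thus "AE x in M. \<forall>k. norm (u * (u * x) ^ k) \<le> \<bar>u\<bar> * (\<bar>u\<bar> * C) ^ k"
        by eventually_elim (simp add: abs_mult power_abs mult_left_mono power_mono)
      show "summable (\<lambda>k. \<bar>u\<bar> * (\<bar>u\<bar> * C) ^ k)"
        using uC C(2) by (intro summable_mult summable_geometric) simp
      show "AE x in M. (\<lambda>k. u * (u * x) ^ k) sums (u / (1 - u * x))"
        using b
      proof eventually_elim
        case (elim x)
        hence "norm (u * x) < 1" using uC by simp
        from sums_mult[OF geometric_sums[OF this], of u] show ?case by simp
      qed
    qed auto
    hence "(\<lambda>k. fps_nth (cauchy_series M) (Suc k) * u ^ Suc k) sums (\<integral>x. u / (1 - u * x) \<partial>M)"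
      by (simp add: power_mult_distrib mult_ac)
    thus ?thesis
      by (subst (asm) sums_Suc_iff) simp
  qed
  have "eventually (\<lambda>u. \<bar>u\<bar> < 1 / C) (nhds 0)"
    using eventually_nhds_ball[of "1 / C" "0::real"] C(2) by (auto elim!: eventually_mono)
  thus "eventually (\<lambda>u. (\<lambda>k. fps_nth (cauchy_series M) k * u ^ k) sums
      (\<integral>x. u / (1 - u * x) \<partial>M)) (nhds 0)"
    by eventually_elim (rule sums)
qed

text \<open>A nonzero power series has isolated zeros, so the difference of two expansions of one function
  vanishes.\<close>

lemma real_fps_expansion_unique:
  fixes F G :: "real fps"
  assumes "f has_fps_expansion F" "f has_fps_expansion G"
  shows "F = G"
proof (rule ccontr)
  assume "F \<noteq> G"
  define D where "D = F - G"
  have D: "(\<lambda>_. 0) has_fps_expansion D"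
    using has_fps_expansion_diff[OF assms] by (simp add: D_def)
  have rad: "fps_conv_radius D > 0" and ev: "eventually (\<lambda>z. eval_fps D z = 0) (nhds 0)"
    using D by (auto simp: has_fps_expansion_def)
  have D0: "eval_fps D 0 = 0" using eventually_nhds_x_imp_x[OF ev] .
  obtain m where m: "fps_nth D m \<noteq> 0"
    using \<open>F \<noteq> G\<close> by (auto simp: D_def fps_eq_iff)
  have "m > 0" using m D0 by (cases m) (auto simp: eval_fps_at_0)
  obtain e where e: "e > 0" "ereal e < fps_conv_radius D"
    using rad ereal_dense2[of 0 "fps_conv_radius D"] by (auto simp: zero_ereal_def)
  have "(\<lambda>n. fps_nth D n * (x - 0) ^ n) sums eval_fps D x" if "norm (x - 0) < e" for x
    using that e(2) sums_eval_fps[of x D] by (simp add: less_trans[of "ereal \<bar>x\<bar>" "ereal e"])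
  from powser_0_nonzero[OF e(1) this D0 m \<open>m > 0\<close>]
  obtain s where s: "0 < s" "\<And>z. z \<in> cball 0 s - {0} \<Longrightarrow> eval_fps D z \<noteq> 0" by metis
  obtain d where d: "d > 0" "\<And>z. dist z 0 < d \<Longrightarrow> eval_fps D z = 0"
    using ev by (auto simp: eventually_nhds_metric)
  define z where "z = min s d / 2"
  have "\<bar>z\<bar> \<le> s" "z \<noteq> 0" "\<bar>z\<bar> < d"
    using s(1) d(1) by (auto simp: z_def)
  thus False using s(2)[of z] d(2)[of z] by simp
qed

lemma inverse_one_minus_const_fps_X:
  "inverse (1 - fps_const c * fps_X) = Abs_fps (\<lambda>k. (c :: 'a::field) ^ k)"
proof (rule fps_inverse_unique, rule fps_ext)
  fix n show "fps_nth ((1 - fps_const c * fps_X) * Abs_fps (\<lambda>k. c ^ k)) n = fps_nth 1 n"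
    by (cases n) (auto simp: left_diff_distrib mult.assoc)
qed

lemma integral_atomic_measure:
  fixes f :: "real \<Rightarrow> 'b::{banach, second_countable_topology}"
  assumes "\<And>j. j \<in> {1..r} \<Longrightarrow> q j \<ge> 0" and [measurable]: "f \<in> borel_measurable borel"
  shows "(\<integral>x. f x \<partial>atomic_measure r q a) = (\<Sum>j=1..r. q j *\<^sub>R f (a j))"
proof -
  have "(\<integral>x. f x \<partial>atomic_measure r q a) = (\<integral>j. f (a j) \<partial>point_measure {1..r} (\<lambda>j. ennreal (q j)))"
    unfolding atomic_measure_def by (rule integral_distr) auto
  also have "\<dots> = (\<Sum>j=1..r. q j *\<^sub>R f (a j))"
    by (rule lebesgue_integral_point_measure_finite) (use assms(1) in auto)
  finally show ?thesis .
qed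

lemma cauchy_series_atomic_measure:
  assumes "\<And>j. j \<in> {1..r} \<Longrightarrow> q j \<ge> 0"
  shows "cauchy_series (atomic_measure r q a) =
    (\<Sum>j=1..r. fps_const (q j) * (fps_X * inverse (1 - fps_const (a j) * fps_X)))"
proof (rule fps_ext)
  fix n show "fps_nth (cauchy_series (atomic_measure r q a)) n =
    fps_nth (\<Sum>j=1..r. fps_const (q j) * (fps_X * inverse (1 - fps_const (a j) * fps_X))) n"
    using integral_atomic_measure[of r q "\<lambda>x. x ^ (n - 1)" a] assms
    by (cases n) (simp_all add: inverse_one_minus_const_fps_X fps_sum_nth)
qed

lemma fps_inv_unique_left:
  fixes f w :: "'a::field fps"
  assumes "fps_nth f 0 = 0" "fps_nth f 1 \<noteq> 0" "fps_nth w 0 = 0" "f oo w = fps_X"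
  shows "fps_inv f = w"
proof -
  have "fps_inv f = fps_inv f oo (f oo w)" by (simp add: assms)
  also have "\<dots> = (fps_inv f oo f) oo w" by (rule fps_compose_assoc) (use assms in auto)
  also have "\<dots> = w" using assms by (simp add: fps_inv)
  finally show ?thesis .
qed

text \<open>With \<open>v = X / (1 - X g)\<close> the hypothesis says \<open>g = \<eta> \<circ> v\<close>. In the variable \<open>z = 1/X\<close> this is the
  subordination relation \<open>G(z) = G\<^sub>\<eta>(z - G(z))\<close>. Composing with the inverse of \<open>g\<close> turns it into a formula
  for the inverse of \<open>\<eta>\<close>.\<close>

lemma fps_inv_subordination:
  fixes g :: "'a::field fps" and q a :: "'b \<Rightarrow> 'a" and J :: "'b set"
  defines "\<eta> \<equiv> (\<Sum>j\<in>J. fps_const (q j) * (fps_X * inverse (1 - fps_const (a j) * fps_X)))"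
  assumes g: "fps_nth g 0 = 0" "fps_nth g 1 = 1" and \<eta>1: "fps_nth \<eta> 1 \<noteq> 0"
    and eq: "g = (\<Sum>j\<in>J. fps_const (q j) * (fps_X * inverse (1 - fps_const (a j) * fps_X - fps_X * g)))"
  shows "fps_inv \<eta> = fps_inv g * inverse (1 - fps_X * fps_inv g)"
proof -
  define h where "h = fps_inv g"
  define v where "v = fps_X * inverse (1 - fps_X * g)"
  define w where "w = h * inverse (1 - fps_X * h)"
  have h0: "fps_nth h 0 = 0" by (simp add: h_def fps_inv_def)
  have v0: "fps_nth v 0 = 0" and w0: "fps_nth w 0 = 0" by (simp_all add: v_def w_def h0)
  have D: "(1 - fps_X * g) * inverse (1 - fps_X * g) = 1"
    by (simp add: inverse_mult_eq_1')
  have comp: "(fps_X * inverse (1 - fps_const c * fps_X)) oo v =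
      fps_X * inverse (1 - fps_const c * fps_X - fps_X * g)" for c
  proof -
    have "(fps_X * inverse (1 - fps_const c * fps_X)) oo v =
        v * inverse ((1 - fps_const c * fps_X) oo v)"
      by (simp add: fps_compose_mult_distrib v0 fps_inverse_compose)
    also have "(1 - fps_const c * fps_X) oo v = 1 - fps_const c * v"
      by (simp add: fps_compose_sub_distrib fps_compose_mult_distrib v0)
    also have "1 - fps_const c * v = (1 - fps_const c * fps_X - fps_X * g) * inverse (1 - fps_X * g)"
      using D by (simp add: v_def algebra_simps)
    also have "v * inverse \<dots> = fps_X * (inverse (1 - fps_X * g) * inverse (inverse (1 - fps_X * g)))
        * inverse (1 - fps_const c * fps_X - fps_X * g)"
      by (simp add: v_def fps_inverse_mult mult_ac del: fps_inverse_idempotent)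
    also have "inverse (1 - fps_X * g) * inverse (inverse (1 - fps_X * g)) = 1"
      by (rule inverse_mult_eq_1') simp
    finally show ?thesis by simp
  qed
  have g_eq: "g = \<eta> oo v"
    by (subst eq) (simp add: \<eta>_def fps_compose_sum_distrib fps_compose_mult_distrib[OF v0,
        of "fps_const _"] comp)
  have "fps_X = g oo h"
    using g by (simp add: h_def fps_inv_right)
  also have "\<dots> = \<eta> oo (v oo h)"
    by (subst g_eq) (simp add: fps_compose_assoc v0 h0)
  also have "v oo h = h * inverse (1 - h * (g oo h))"
    using g by (simp add: v_def fps_compose_mult_distrib h0 fps_inverse_compose fps_compose_sub_distrib)
  also have "\<dots> = w"
    using g by (simp add: w_def h_def fps_inv_right mult_ac)
  finally have "fps_inv \<eta> = w"
    using \<eta>1 w0 by (intro fps_inv_unique_left) (auto simp: \<eta>_def fps_sum_nth)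
  thus ?thesis by (simp add: w_def h_def)
qed

lemma fps_inv_nonzero:
  fixes g :: "'a::field fps"
  assumes "fps_nth g 0 = 0" "fps_nth g 1 \<noteq> 0"
  shows "fps_inv g \<noteq> 0"
  using fps_inv[OF assms] by (metis fps_X_neq_zero fps_compose_0)

text \<open>Taking reciprocals in \<open>fps_inv_subordination\<close> makes the relation additive; this is where adding
  the semicircle distribution comes from.\<close>

lemma K_series_subordination:
  assumes q: "\<And>j. j \<in> {1..r} \<Longrightarrow> q j \<ge> 0" "(\<Sum>j=1..r. q j) = 1"
    and M: "real_distribution M"
    and eq: "cauchy_series M = (\<Sum>j=1..r. fps_const (q j) *
      (fps_X * inverse (1 - fps_const (a j) * fps_X - fps_X * cauchy_series M)))"
  shows "K_series M = K_series (atomic_measure r q a) + fls_X"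
proof -
  let ?g = "cauchy_series M" and ?\<eta> = "cauchy_series (atomic_measure r q a)"
  define h where "h = fps_inv ?g"
  have g1: "fps_nth ?g 1 = 1" by (rule cauchy_series_nth_1[OF M])
  have \<eta>: "?\<eta> = (\<Sum>j=1..r. fps_const (q j) * (fps_X * inverse (1 - fps_const (a j) * fps_X)))"
    by (rule cauchy_series_atomic_measure[OF q(1)])
  have \<eta>1: "fps_nth ?\<eta> 1 = 1"
    unfolding \<eta> using q(2) by (simp add: fps_sum_nth)
  have "fps_inv ?\<eta> = h * inverse (1 - fps_X * h)"
    unfolding h_def \<eta>
  proof (rule fps_inv_subordination)
    show "fps_nth (\<Sum>j=1..r. fps_const (q j) * (fps_X * inverse (1 - fps_const (a j) * fps_X))) 1 \<noteq> 0"
      unfolding \<eta>[symmetric] \<eta>1 by simp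
  qed (use g1 eq in simp_all)
  hence "K_series (atomic_measure r q a) = inverse (fps_to_fls (h * inverse (1 - fps_X * h)))"
    by (simp add: K_series_def)
  also have "\<dots> = inverse (fps_to_fls h) * (1 - fls_X * fps_to_fls h)"
    by (simp add: fls_times_fps_to_fls h_def flip: fls_inverse_fps_to_fls)
  also have "\<dots> = inverse (fps_to_fls h) - fls_X"
    using fps_inv_nonzero[of ?g] g1 by (simp add: h_def right_diff_distrib)
  finally show ?thesis by (simp add: K_series_def h_def)
qed

text \<open>Substituting \<open>u = 1/z\<close> makes both sides analytic near \<open>u = 0\<close>, and their expansions agree.\<close>

lemma cauchy_series_functional_equation:
  assumes M: "real_distribution M" "AE x in M. \<bar>x\<bar> \<le> B"
    and eq: "\<And>z. z > C \<or> z < - C \<Longrightarrow> (\<integral>x. 1 / (z - x) \<partial>M) =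
        (\<Sum>j\<in>J. q j / (z - a j - (\<integral>x. 1 / (z - x) \<partial>M)))"
  shows "cauchy_series M = (\<Sum>j\<in>J. fps_const (q j) *
      (fps_X * inverse (1 - fps_const (a j) * fps_X - fps_X * cauchy_series M)))"
proof (rule real_fps_expansion_unique)
  let ?g = "\<lambda>u. \<integral>x. u / (1 - u * x) \<partial>M"
  show g: "?g has_fps_expansion cauchy_series M"
    by (rule has_fps_expansion_cauchy_series[OF M])
  have exp: "(\<lambda>u. \<Sum>j\<in>J. q j * (u * inverse (1 - a j * u - u * ?g u))) has_fps_expansion
      (\<Sum>j\<in>J. fps_const (q j) * (fps_X * inverse (1 - fps_const (a j) * fps_X - fps_X * cauchy_series
          M)))"
    by (intro fps_expansion_intros g) auto
  have ev: "eventually (\<lambda>u. ?g u = (\<Sum>j\<in>J. q j * (u * inverse (1 - a j * u - u * ?g u)))) (nhds 0)"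
  proof -
    define D where "D = max C 1"
    have "eventually (\<lambda>u::real. \<bar>u\<bar> < 1 / D) (nhds 0)"
      using eventually_nhds_ball[of "1 / D" "0::real"] by (auto simp: D_def elim!: eventually_mono)
    thus ?thesis
    proof eventually_elim
      case (elim u)
      show ?case
      proof (cases "u = 0")
        case False
        have *: "?g u = (\<integral>x. 1 / (1 / u - x) \<partial>M)"
          using False by (intro Bochner_Integration.integral_cong) (auto simp: field_simps)
        have "D > 0" by (simp add: D_def)
        hence "1 / \<bar>u\<bar> > D" using elim False by (simp add: field_simps)
        hence "1 / u > C \<or> 1 / u < - C" by (auto simp: D_def abs_if split: if_splits)
        from eq[OF this] have "?g u = (\<Sum>j\<in>J. q j / (1 / u - a j - ?g u))"
          unfolding * .
        also have "\<dots> = (\<Sum>j\<in>J. q j * (u * inverse (1 - a j * u - u * ?g u)))"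
        proof (intro sum.cong refl)
          fix j
          have "1 / u - a j - ?g u = (1 - a j * u - u * ?g u) / u"
            using False by (simp add: field_simps)
          thus "q j / (1 / u - a j - ?g u) = q j * (u * inverse (1 - a j * u - u * ?g u))"
            by (simp add: divide_inverse)
        qed
        finally show ?thesis .
      qed simp
    qed
  qed
  show "?g has_fps_expansion (\<Sum>j\<in>J. fps_const (q j) *
      (fps_X * inverse (1 - fps_const (a j) * fps_X - fps_X * cauchy_series M)))"
    using exp ev unfolding has_fps_expansion_def by (auto elim: eventually_elim2)
qed

section \<open>The semicircle distribution\<close>

definition semicircle_integral :: "nat \<Rightarrow> real" where
  "semicircle_integral k = integral {-2..2} (\<lambda>x. x ^ k * sqrt (4 - x\<^sup>2))"

lemma four_minus_square_nonneg: "x \<in> {-2..2} \<Longrightarrow> 0 \<le> 4 - (x::real)\<^sup>2"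
  using mult_nonneg_nonneg[of "2 - x" "2 + x"] by (simp add: algebra_simps power2_eq_square)

lemma four_minus_square_pos: "x \<in> {-2<..<2} \<Longrightarrow> 0 < 4 - (x::real)\<^sup>2"
  using mult_pos_pos[of "2 - x" "2 + x"] by (simp add: algebra_simps power2_eq_square)

lemma semicircle_moment: "(\<integral>x. x ^ k \<partial>semicircle) = semicircle_integral k / (2 * pi)"
proof -
  have cont: "continuous_on {-2..2::real} (\<lambda>x. x ^ k * sqrt (4 - x\<^sup>2))"
    by (intro continuous_intros)
  have "(\<integral>x. x ^ k \<partial>semicircle) =
      (\<integral>x. (indicator {-2..2} x * (sqrt (4 - x\<^sup>2) / (2 * pi))) *\<^sub>R x ^ k \<partial>lborel)"
    unfolding semicircle_def by (rule integral_density)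
       (auto simp: indicator_def intro!: AE_I2 divide_nonneg_pos real_sqrt_ge_zero
           four_minus_square_nonneg[simplified])
  also have "\<dots> = (\<integral>x. indicator {-2..2} x *\<^sub>R (x ^ k * sqrt (4 - x\<^sup>2)) / (2 * pi) \<partial>lborel)"
    by (intro Bochner_Integration.integral_cong) auto
  also have "\<dots> = (LINT x:{-2..2}|lborel. x ^ k * sqrt (4 - x\<^sup>2)) / (2 * pi)"
    unfolding set_lebesgue_integral_def by (rule integral_divide_zero)
  also have "(LINT x:{-2..2}|lborel. x ^ k * sqrt (4 - x\<^sup>2)) = semicircle_integral k"
    unfolding semicircle_integral_def
    by (rule set_borel_integral_eq_integral(2)[OF borel_integrable_atLeastAtMost'[OF cont]])
  finally show ?thesis .
qed

lemma semicircle_has_integral: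
  "((\<lambda>x. x ^ k * sqrt (4 - x\<^sup>2)) has_integral semicircle_integral k) {-2..2}"
  unfolding semicircle_integral_def
  by (intro integrable_integral integrable_continuous_interval continuous_intros)

lemma semicircle_integral_0: "semicircle_integral 0 = 2 * pi"
proof -
  \<comment> \<open>The elementary antiderivative of \<open>(4 - x\<^sup>2)\<^bsup>1/2\<^esup>\<close>.\<close>
  let ?F = "\<lambda>x::real. x * sqrt (4 - x\<^sup>2) / 2 + 2 * arcsin (x / 2)"
  have "((\<lambda>x. x ^ 0 * sqrt (4 - x\<^sup>2)) has_integral (?F 2 - ?F (-2))) {-2..2}"
  proof (rule fundamental_theorem_of_calculus_interior)
    show "continuous_on {-2..2} ?F"
      by (intro continuous_intros) auto
    fix x :: real assume "x \<in> {-2<..<2}"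
    hence pos: "4 - x\<^sup>2 > 0" and x: "-1 < x / 2" "x / 2 < 1"
      using four_minus_square_pos[of x] by auto
    define s where "s = sqrt (4 - x\<^sup>2)"
    have s: "s > 0" "s\<^sup>2 = 4 - x\<^sup>2" using pos by (auto simp: s_def)
    have "sqrt (1 - (x / 2)\<^sup>2) = sqrt ((4 - x\<^sup>2) / 4)" by (simp add: power_divide diff_divide_distrib)
    hence s2: "sqrt (1 - (x / 2)\<^sup>2) = s / 2" by (simp add: real_sqrt_divide s_def)
    have "(?F has_real_derivative (s + x * (- (2 * x) / (2 * s))) / 2 + 2 * ((1 / 2) / (s / 2))) (at x)"
      unfolding s2[symmetric] unfolding s_def
      using pos x by (auto intro!: derivative_eq_intros simp: field_simps)
    also have "(s + x * (- (2 * x) / (2 * s))) / 2 + 2 * ((1 / 2) / (s / 2)) = s"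
      using s by (simp add: field_simps power2_eq_square)
    finally show "(?F has_vector_derivative x ^ 0 * sqrt (4 - x\<^sup>2)) (at x)"
      by (simp add: s_def has_real_derivative_iff_has_vector_derivative)
  qed simp
  moreover have "?F 2 - ?F (-2) = 2 * pi"
    by (simp add: arcsin_minus)
  ultimately show ?thesis
    using has_integral_unique[OF semicircle_has_integral[of 0]] by metis
qed

lemma semicircle_cube_derivative:
  assumes "x \<in> {-2<..<2}"
  shows "((\<lambda>x. sqrt (4 - x\<^sup>2) ^ 3) has_real_derivative - 3 * x * sqrt (4 - x\<^sup>2)) (at x)"
proof -
  have pos: "4 - x\<^sup>2 > 0" using assms by (rule four_minus_square_pos)
  have "((\<lambda>x. sqrt (4 - x\<^sup>2) ^ 3) has_real_derivative
      3 * sqrt (4 - x\<^sup>2) ^ 2 * (- (2 * x) * (inverse (sqrt (4 - x\<^sup>2)) / 2))) (at x)"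
    using pos by (auto intro!: derivative_eq_intros)
  also have "3 * sqrt (4 - x\<^sup>2) ^ 2 * (- (2 * x) * (inverse (sqrt (4 - x\<^sup>2)) / 2)) =
      - 3 * x * sqrt (4 - x\<^sup>2)"
    using pos by (simp add: power2_eq_square field_simps del: real_sqrt_pow2 real_sqrt_mult_self)
  finally show ?thesis .
qed

lemma semicircle_integral_1: "semicircle_integral 1 = 0"
proof -
  let ?F = "\<lambda>x::real. sqrt (4 - x\<^sup>2) ^ 3"
  have A: "((\<lambda>x. - 3 * x * sqrt (4 - x\<^sup>2)) has_integral (?F 2 - ?F (-2))) {-2..2}"
    by (rule fundamental_theorem_of_calculus_interior)
       (auto intro!: continuous_intros semicircle_cube_derivative[simplified]
             simp flip: has_real_derivative_iff_has_vector_derivative)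
  have "((\<lambda>x. - 3 * (x ^ 1 * sqrt (4 - x\<^sup>2))) has_integral - 3 * semicircle_integral 1) {-2..2}"
    by (intro has_integral_mult_right semicircle_has_integral)
  hence B: "((\<lambda>x. - 3 * x * sqrt (4 - x\<^sup>2)) has_integral - 3 * semicircle_integral 1) {-2..2}"
    by (simp only: mult.assoc power_one_right)
  show ?thesis
    using has_integral_unique[OF A B] by simp
qed

text \<open>The product of a monomial with \<open>(4 - x\<^sup>2)\<^bsup>3/2\<^esup>\<close> vanishes at both ends of the interval, and its
  derivative is a combination of two of the moment integrands. This gives the recursion for the moments.\<close>

lemma semicircle_integral_rec:
  "real (k + 4) * semicircle_integral (k + 2) = 4 * real (k + 1) * semicircle_integral k"
proof -
  let ?F = "\<lambda>x::real. x ^ (k + 1) * sqrt (4 - x\<^sup>2) ^ 3"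
  let ?f = "\<lambda>x::real. 4 * real (k + 1) * (x ^ k * sqrt (4 - x\<^sup>2)) - real (k +
      4) * (x ^ (k + 2) * sqrt (4 - x\<^sup>2))"
  have "(?f has_integral (?F 2 - ?F (-2))) {-2..2}"
  proof (rule fundamental_theorem_of_calculus_interior)
    show "continuous_on {-2..2} ?F"
      by (intro continuous_intros)
    fix x :: real assume x: "x \<in> {-2<..<2}"
    have pos: "4 - x\<^sup>2 > 0" using x by (rule four_minus_square_pos)
    define s where "s = sqrt (4 - x\<^sup>2)"
    have s: "s ^ 3 = s * (4 - x\<^sup>2)" using pos by (simp add: s_def power3_eq_cube)
    have "(?F has_real_derivative real (k + 1) * x ^ k * s ^ 3 + x ^ (k + 1) * (- 3 * x * s)) (at x)"
      unfolding s_def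
      by (rule DERIV_cong[OF DERIV_mult'[OF DERIV_pow[of "k + 1"] semicircle_cube_derivative[OF
          x]]]) simp
    also have "real (k + 1) * x ^ k * s ^ 3 + x ^ (k + 1) * (- 3 * x * s) = ?f x"
      unfolding s by (simp add: s_def algebra_simps power2_eq_square)
    finally show "(?F has_vector_derivative ?f x) (at x)"
      by (simp add: has_real_derivative_iff_has_vector_derivative)
  qed simp
  hence A: "(?f has_integral 0) {-2..2}" by simp
  have B: "(?f has_integral (4 * real (k + 1) * semicircle_integral k - real (k +
      4) * semicircle_integral (k + 2))) {-2..2}"
    by (intro has_integral_diff has_integral_mult_right semicircle_has_integral)
  show ?thesis
    using has_integral_unique[OF A B] by simp
qed

text \<open>For \<open>h = 1 - 2 X g\<close> the recursion of the moments is the differential equation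
  \<open>(1 - 4 X\<^sup>2) h' = - 4 X h\<close>, which \<open>(1 - 4 X\<^sup>2)\<^bsup>1/2\<^esup>\<close> satisfies as well. So \<open>h\<^sup>2 = 1 - 4 X\<^sup>2\<close>, and this is
  the quadratic equation for \<open>g\<close>.\<close>

lemma cauchy_series_semicircle:
  "cauchy_series semicircle = fps_X * (1 + cauchy_series semicircle ^ 2)"
proof -
  let ?g = "cauchy_series semicircle"
  define m where "m k = (\<integral>x. x ^ k \<partial>semicircle)" for k
  have m_eq: "m k = semicircle_integral k / (2 * pi)" for k
    unfolding m_def by (rule semicircle_moment)
  have m: "m 0 = 1" "m 1 = 0" "real (k + 4) * m (k + 2) = 4 * real (k + 1) * m k" for k
    using semicircle_integral_rec[of k]
    unfolding m_eq
    by (simp_all add: semicircle_integral_0 semicircle_integral_1 field_simps del: One_nat_def)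
  define h where "h = 1 - 2 * fps_X * ?g"
  define s :: "real fps" where "s = 1 - 4 * fps_X ^ 2"
  have h_nth: "fps_nth h 0 = 1" "fps_nth h 1 = 0" "fps_nth h (k + 2) = - 2 * m k" for k
    by (simp_all add: h_def m_def mult.assoc numeral_fps_const)
  have ode: "s * fps_deriv h = - 4 * fps_X * h"
  proof (rule fps_ext)
    fix n
    have rec: "real (j + 2) * fps_nth h (j + 2) = 4 * (real j - 1) * fps_nth h j" for j
    proof -
      consider "j = 0" | "j = 1" | i where "j = i + 2"
        by (metis One_nat_def add_2_eq_Suc' not0_implies_Suc)
      thus ?thesis
      proof cases
        case 1
        thus ?thesis using h_nth(3)[of 0] h_nth(1) m(1) by simp
      next
        case 2
        thus ?thesis using h_nth(3)[of 1] m(2) by simp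
      next
        case 3
        thus ?thesis using h_nth(3)[of "i + 2"] h_nth(3)[of i] m(3)[of i] by (simp add: algebra_simps)
      qed
    qed
    show "fps_nth (s * fps_deriv h) n = fps_nth (- 4 * fps_X * h) n"
    proof (cases n)
      case 0
      thus ?thesis using h_nth(2)
        by (simp add: s_def left_diff_distrib mult.assoc numeral_fps_const power2_eq_square)
    next
      case (Suc j)
      have "fps_nth (s * fps_deriv h) n = real (j + 2) * fps_nth h (j + 2) - 4 * (real j * fps_nth h j)"
        using Suc
        by (cases j) (simp_all add: s_def left_diff_distrib mult.assoc numeral_fps_const
            power2_eq_square)
      also have "\<dots> = - 4 * fps_nth h j"
        unfolding rec by (simp add: algebra_simps)
      finally show ?thesis
        using Suc
        by (simp add: mult.assoc numeral_fps_const fps_const_neg[symmetric] del: fps_const_neg)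
    qed
  qed
  have s0: "fps_nth s 0 = 1" by (simp add: s_def)
  have ds: "fps_deriv s = - 8 * fps_X"
    by (simp add: s_def fps_deriv_power numeral_fps_const)
  \<comment> \<open>Both \<open>h\<^sup>2\<close> and \<open>s\<close> solve the same first order equation, so their quotient is constant.\<close>
  define y where "y = h ^ 2 * inverse s"
  have inv_s: "s * inverse s = 1" using s0 by (intro inverse_mult_eq_1') simp
  have "fps_deriv y = 2 * h * fps_deriv h * inverse s - h ^ 2 * (fps_deriv s * inverse s * inverse s)"
    using s0 by (simp add: y_def fps_inverse_deriv power2_eq_square algebra_simps)
  hence "s * s * fps_deriv y =
      s * inverse s * (2 * h * (s * fps_deriv h)) - (s * inverse s) * (s * inverse s)
      * (h ^ 2 * fps_deriv s)"
    by (simp only:) (simp add: algebra_simps)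
  also have "\<dots> = 0"
    unfolding ode inv_s ds by (simp add: power2_eq_square algebra_simps)
  finally have "s * s * fps_deriv y = 0" .
  moreover have "s \<noteq> 0" using s0 by auto
  ultimately have "fps_deriv y = 0"
    by (metis mult_eq_0_iff)
  hence "y = fps_const (fps_nth y 0)" by simp
  also have "fps_nth y 0 = 1" using h_nth(1) s0 by (simp add: y_def power2_eq_square)
  finally have y1: "h ^ 2 * inverse s = 1" by (simp add: y_def)
  have "h ^ 2 * (s * inverse s) = s * (h ^ 2 * inverse s)" by (simp only: mult_ac)
  hence "h ^ 2 = s" unfolding y1 inv_s by simp
  hence "(4 * fps_X) * (fps_X * (1 + ?g ^ 2)) = (4 * fps_X) * ?g"
    by (simp add: h_def s_def power2_eq_square algebra_simps)
  thus ?thesis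
    by simp
qed

lemma K_series_semicircle: "K_series semicircle = inverse fls_X + fls_X"
proof -
  let ?g = "cauchy_series semicircle"
  define h where "h = fps_inv ?g"
  have g: "fps_nth ?g 0 = 0" "fps_nth ?g 1 = 1"
    using semicircle_moment[of 0] by (simp_all add: semicircle_integral_0 One_nat_def del: power_0)
  have h0: "fps_nth h 0 = 0" by (simp add: h_def fps_inv_def)
  have gh: "?g oo h = fps_X"
    using g by (simp add: h_def fps_inv_right)
  have "fps_X = (fps_X * (1 + ?g ^ 2)) oo h"
    by (simp add: gh flip: cauchy_series_semicircle)
  also have "\<dots> = h * (1 + fps_X ^ 2)"
    by (simp add: fps_compose_mult_distrib fps_compose_add_distrib h0 gh flip: fps_compose_power)
  finally have fls_eq: "fps_to_fls h * (1 + fls_X ^ 2) = fls_X"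
    by (metis fps_X_to_fls fls_times_fps_to_fls fps_to_fls_plus fps_to_fls_power fps_one_to_fls)
  have "inverse y = inverse x + x" if "y * (1 + x ^ 2) = x" "x \<noteq> 0" for x y :: "real fls"
  proof -
    have "inverse x + x = (1 + x ^ 2) * inverse x"
      using that(2) by (simp add: distrib_right power2_eq_square mult.assoc)
    hence "y * (inverse x + x) = 1"
      using that by (simp flip: mult.assoc)
    thus ?thesis by (rule inverse_unique)
  qed
  from this[OF fls_eq] show ?thesis
    by (simp add: K_series_def h_def)
qed

lemma R_transform_semicircle: "R_transform semicircle = fls_X"
  by (simp add: R_transform_def K_series_semicircle)

section \<open>The Cauchy transform off the support\<close>

text \<open>Around a point at distance \<open>d\<close> from the support, integrating the geometric series of
  \<open>1 / (z - x)\<close> gives a power series that converges in the disc of radius \<open>d\<close>.\<close>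

lemma holomorphic_cauchy_transform:
  assumes M: "real_distribution M"
  shows "cauchy_transform M holomorphic_on - (complex_of_real ` measure_support M)"
proof -
  interpret real_distribution M by fact
  have closed: "closed (complex_of_real ` measure_support M)"
    using closed_measure_support
    by (intro closed_injective_linear_image) (auto intro: linearI simp: scaleR_conv_of_real inj_on_def)
  have "cauchy_transform M analytic_on - (complex_of_real ` measure_support M)"
    unfolding analytic_on_def
  proof
    fix z0 assume "z0 \<in> - (complex_of_real ` measure_support M)"
    then obtain d where d: "d > 0" "ball z0 d \<subseteq> - (complex_of_real ` measure_support M)"
      using openE[OF open_Compl[OF closed]] by metis
    have far: "AE x in M. d \<le> cmod (z0 - of_real x)"
      using AE_in_measure_support[OF events_eq_borel]
    proof eventually_elim
      case (elim x)
      thus ?case using d(2) by (force simp: dist_norm not_le)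
    qed
    have "cauchy_transform M holomorphic_on ball z0 d"
    proof (rule power_series_holomorphic)
      fix z assume "z \<in> ball z0 d"
      hence z: "cmod (z - z0) < d" by (simp add: dist_norm norm_minus_commute)
      have "(\<lambda>k. \<integral>x. (- 1) ^ k / (z0 - of_real x) ^ Suc k * (z - z0) ^ k \<partial>M) sums cauchy_transform M z"
        unfolding cauchy_transform_def
      proof (rule bounded_sums_integral)
        show "AE x in M. \<forall>k. norm ((- 1) ^ k / (z0 - of_real x) ^ Suc k * (z - z0) ^ k) \<le>
            (1 / d) * (cmod (z - z0) / d) ^ k"
          using far
        proof eventually_elim
          case (elim x)
          have "norm ((- 1) ^ k / (z0 - of_real x) ^ Suc k * (z - z0) ^ k) =
              cmod (z - z0) ^ k / cmod (z0 - of_real x) ^ Suc k" for k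
            by (simp add: norm_mult norm_divide norm_power)
          moreover have "cmod (z - z0) ^ k / cmod (z0 - of_real x) ^ Suc k \<le>
              cmod (z - z0) ^ k / d ^ Suc k" for k
            using d(1) elim by (intro divide_left_mono power_mono mult_pos_pos zero_less_power) auto
          ultimately show ?case by (simp add: power_divide)
        qed
        show "summable (\<lambda>k. (1 / d) * (cmod (z - z0) / d) ^ k)"
          using d(1) z by (intro summable_mult summable_geometric) (simp add: divide_less_eq)
        show "AE x in M. (\<lambda>k. (- 1) ^ k / (z0 - of_real x) ^ Suc k * (z - z0) ^ k) sums
            (1 / (z - of_real x))"
          using far
        proof eventually_elim
          case (elim x)
          define y where "y = z0 - of_real x"
          have y: "y \<noteq> 0" "cmod (- (z - z0) / y) < 1"
            using elim d(1) z by (auto simp: y_def norm_divide divide_less_eq norm_minus_commute)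
          have "y + (z - z0) \<noteq> 0"
          proof
            assume "y + (z - z0) = 0"
            hence "- (z - z0) / y = 1" using y(1) by (simp add: add_eq_0_iff)
            thus False using y(2) by simp
          qed
          hence "1 / y * (1 / (1 - (- (z - z0) / y))) = 1 / (z - of_real x)"
            using y(1) by (simp add: divide_simps) (simp add: y_def)
          thus ?case
            using sums_mult[OF geometric_sums[OF y(2)], of "1 / y"]
            by (simp add: y_def[symmetric] power_divide power_minus[of "z - z0"] power_minus[of
                "z0 - z"] mult_ac)
               (simp add: power_mult_distrib[symmetric] divide_inverse mult_ac)
        qed
      qed auto
      thus "(\<lambda>k. (\<integral>x. (- 1) ^ k / (z0 - of_real x) ^ Suc k \<partial>M) * (z - z0) ^ k) sums
          cauchy_transform M z"
        by (simp only: integral_mult_left_zero)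
    qed
    thus "\<exists>e>0. cauchy_transform M holomorphic_on ball z0 e" using d(1) by blast
  qed
  thus ?thesis by (rule analytic_imp_holomorphic)
qed

text \<open>Two open half planes, joined by a vertical line to the right of \<open>K\<close>, form a connected set that is
  dense in the plane.\<close>

lemma connected_Compl_real_set:
  assumes "bounded K"
  shows "connected (- (complex_of_real ` K))"
proof -
  obtain B where B: "\<And>x. x \<in> K \<Longrightarrow> \<bar>x\<bar> \<le> B" using assms by (auto simp: bounded_iff)
  define L where "L = {z. Re z = B + 1}"
  define T where "T = ({z. Im z > 0} \<union> L) \<union> ({z. Im z < 0} \<union> L)"
  have conv: "convex {z. Im z > 0}" "convex {z. Im z < 0}" "convex L"
    using convex_hyperplane[of "1::complex" "B + 1"]
    by (simp_all add: L_def convex_halfspace_Im_gt convex_halfspace_Im_lt inner_complex_def)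
  have conn: "connected T"
    unfolding T_def
  proof (intro connected_Un convex_connected conv)
    have "Complex (B + 1) 1 \<in> {z. Im z > 0} \<inter> L" "Complex (B + 1) (-1) \<in> {z. Im z < 0} \<inter> L"
      "Complex (B + 1) 0 \<in> ({z. Im z > 0} \<union> L) \<inter> ({z. Im z < 0} \<union> L)"
      by (auto simp: L_def)
    thus "{z. Im z > 0} \<inter> L \<noteq> {}" "{z. Im z < 0} \<inter> L \<noteq> {}" "({z. Im z > 0} \<union> L) \<inter> ({z. Im z < 0} \<union>
        L) \<noteq> {}"
      by blast+
  qed
  have sub: "T \<subseteq> - (complex_of_real ` K)"
    using B by (force simp: T_def L_def)
  have cl: "closure T = UNIV"
  proof -
    have "z \<in> closure T" for z
      unfolding closure_approachable
    proof (intro allI impI)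
      fix e :: real assume e: "e > 0"
      define c where "c = (if Im z < 0 then - (e / 2) else e / 2)"
      define w where "w = z + \<i> * of_real c"
      have c: "\<bar>c\<bar> < e" "Im z + c \<noteq> 0" using e by (auto simp: c_def)
      have "Im w \<noteq> 0" using c(2) by (simp add: w_def)
      hence "w \<in> T" unfolding T_def by (cases "Im w > 0") simp_all
      moreover have "dist w z < e" using c(1) by (simp add: w_def dist_norm norm_mult)
      ultimately show "\<exists>y\<in>T. dist y z < e" by blast
    qed
    thus ?thesis by auto
  qed
  show ?thesis
    by (rule connected_intermediate_closure[OF conn sub]) (simp only: cl subset_UNIV)
qed

section \<open>Zero distributions of polynomials\<close>

lemma prob_space_zero_distribution: "prob_space (zero_distribution p)"
  unfolding zero_distribution_def by (intro measure_pmf.prob_space_distr) auto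

lemma space_zero_distribution [simp]: "space (zero_distribution p) = UNIV"
  and sets_zero_distribution [simp, measurable_cong]: "sets (zero_distribution p) = sets borel"
  by (simp_all add: zero_distribution_def)

lemma AE_zero_distribution:
  assumes "degree p > 0" "\<And>z. poly p z = 0 \<Longrightarrow> Q z" "Measurable.pred borel Q"
  shows "AE z in zero_distribution p. Q z"
proof -
  have "proots p \<noteq> {#}" using assms(1) size_proots_complex[of p] by auto
  moreover have "p \<noteq> 0" using assms(1) by auto
  ultimately show ?thesis
    using assms(2,3) unfolding zero_distribution_def
    by (subst AE_distr_iff) (auto simp: AE_measure_pmf_iff)
qed

lemma integral_zero_distribution:
  fixes f :: "complex \<Rightarrow> 'b::{banach, second_countable_topology}"
  assumes "degree p > 0" and [measurable]: "f \<in> borel_measurable borel"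
  shows "(\<integral>z. f z \<partial>zero_distribution p) = (\<Sum>z | poly p z = 0. (order z p / degree p) *\<^sub>R f z)"
proof -
  have ne: "proots p \<noteq> {#}" using assms(1) size_proots_complex[of p] by auto
  have nz: "p \<noteq> 0" using assms(1) by auto
  have "(\<integral>z. f z \<partial>zero_distribution p) = (\<integral>z. f z \<partial>measure_pmf (pmf_of_multiset (proots p)))"
    unfolding zero_distribution_def by (subst integral_distr) auto
  also have "\<dots> = (\<Sum>z | poly p z = 0. pmf (pmf_of_multiset (proots p)) z *\<^sub>R f z)"
    using nz ne by (intro integral_measure_pmf) (auto simp: poly_roots_finite)
  finally show ?thesis
    using nz ne by (simp add: size_proots_complex)
qed

text \<open>This is the logarithmic derivative of the factorization of \<open>p\<close> into linear factors.\<close>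

lemma cauchy_transform_zero_distribution:
  assumes "degree p > 0" "poly p w \<noteq> 0"
  shows "(\<integral>z. 1 / (w - z) \<partial>zero_distribution p) = poly (pderiv p) w / (degree p * poly p w)"
proof -
  let ?R = "{z. poly p z = 0}"
  let ?r = "\<Prod>z\<in>?R. [:- z, 1:] ^ order z p"
  have nz: "p \<noteq> 0" using assms(1) by auto
  have fin: "finite ?R" using nz by (rule poly_roots_finite)
  have p: "p = smult (lead_coeff p) ?r" by (simp add: complex_poly_decompose)
  have "poly (pderiv ?r) w = (\<Sum>z\<in>?R. (order z p / (w - z)) * poly ?r w)"
    unfolding pderiv_prod poly_sum
  proof (intro sum.cong refl)
    fix z assume z: "z \<in> ?R"
    hence "w \<noteq> z" and "order z p > 0" using assms(2) nz by (auto simp: order_gt_0_iff)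
    then obtain k where k: "order z p = Suc k" using gr0_conv_Suc by auto
    define d where "d = w - z"
    have d: "d \<noteq> 0" using \<open>w \<noteq> z\<close> by (simp add: d_def)
    have "poly ?r w = poly ([:- z, 1:] ^ order z p) w * poly (\<Prod>x\<in>?R - {z}. [:- x, 1:] ^ order x p) w"
      using prod.remove[OF fin z, of "\<lambda>z. [:- z, 1:] ^ order z p"] by (simp only: poly_mult)
    hence r: "poly ?r w = d * d ^ k * poly (\<Prod>x\<in>?R - {z}. [:- x, 1:] ^ order x p) w"
      by (simp add: k d_def left_diff_distrib)
    show "poly ((\<Prod>x\<in>?R - {z}. [:- x, 1:] ^ order x p) * pderiv ([:- z, 1:] ^ order z p)) w =
        (order z p / (w - z)) * poly ?r w"
      unfolding r unfolding k pderiv_power_Suc using d by (simp add: pderiv_pCons flip: d_def)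
  qed
  hence "poly (pderiv p) w = (\<Sum>z\<in>?R. order z p / (w - z)) * poly p w"
    by (subst (1 3) p) (simp only: pderiv_smult poly_smult sum_distrib_right sum_distrib_left mult_ac)
  moreover have "(\<integral>z. 1 / (w - z) \<partial>zero_distribution p) =
      (\<Sum>z\<in>?R. (order z p / degree p) *\<^sub>R (1 / (w - z)))"
    by (rule integral_zero_distribution[OF assms(1)]) measurable
  hence "(\<integral>z. 1 / (w - z) \<partial>zero_distribution p) = (\<Sum>z\<in>?R. order z p / (w - z)) / degree p"
    by (simp add: sum_divide_distrib scaleR_conv_of_real mult_ac)
  ultimately show ?thesis using assms by simp
qed

text \<open>Pushing forward along \<open>Re\<close> makes Helly's selection theorem on the line applicable, and it loses
  nothing if all zeros are real.\<close>

definition real_zero_distribution :: "complex poly \<Rightarrow> real measure" where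
  "real_zero_distribution p = distr (zero_distribution p) borel Re"

lemma real_distribution_real_zero_distribution: "real_distribution (real_zero_distribution p)"
proof -
  interpret prob_space "zero_distribution p" by (rule prob_space_zero_distribution)
  have "prob_space (real_zero_distribution p)"
    unfolding real_zero_distribution_def by (rule prob_space_distr) simp
  thus ?thesis
    by (auto intro!: real_distribution.intro real_distribution_axioms.intro
        simp: real_zero_distribution_def)
qed

lemma integral_real_zero_distribution:
  fixes f :: "complex \<Rightarrow> 'b::{banach, second_countable_topology}"
  assumes "degree p > 0" "\<And>z. poly p z = 0 \<Longrightarrow> Im z = 0" and [measurable]: "f \<in> borel_measurable borel"
  shows "(\<integral>x. f (complex_of_real x) \<partial>real_zero_distribution p) = (\<integral>z. f z \<partial>zero_distribution p)"
proof -
  have "(\<integral>x. f (complex_of_real x) \<partial>real_zero_distribution p) =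
      (\<integral>z. f (complex_of_real (Re z)) \<partial>zero_distribution p)"
    unfolding real_zero_distribution_def by (rule integral_distr) measurable
  also have "\<dots> = (\<integral>z. f z \<partial>zero_distribution p)"
  proof (rule integral_cong_AE)
    have "AE z in zero_distribution p. Im z = 0"
      using assms(1,2) by (intro AE_zero_distribution) auto
    thus "AE z in zero_distribution p. f (complex_of_real (Re z)) = f z"
    proof eventually_elim
      case (elim z)
      hence "complex_of_real (Re z) = z" by (simp add: complex_eq_iff)
      thus ?case by simp
    qed
  qed measurable
  finally show ?thesis .
qed

lemma cauchy_transform_hermite:
  assumes N: "N > 0" and A: "\<And>j. j \<in> {1..r} \<Longrightarrow> \<bar>a j\<bar> \<le> A" and m: "(\<Sum>i=1..r. m i) = N"
  defines "p \<equiv> cpoly (rescaled_hermite r a N m)"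
  shows "degree p > 0" and "poly p z = 0 \<Longrightarrow> Im z = 0"
    and "AE x in real_zero_distribution p. \<bar>x\<bar> \<le> A + 2"
    and "cmod z \<ge> A + 2 \<Longrightarrow> cauchy_transform (real_zero_distribution p) z = zero_stieltjes r a N m z"
proof -
  show deg: "degree p > 0"
    using N m by (simp add: p_def degree_map_poly degree_rescaled_hermite)
  show real: "Im z = 0" if "poly p z = 0" for z
    using rescaled_hermite_nonreal[where a = a and z = z and m = m, OF N] m that by (auto simp: p_def)
  have bound: "\<bar>Re z\<bar> \<le> A + 2" if "poly p z = 0" for z
    using zero_stieltjes_outside(1)[where a = a and z = z
        and m = m, OF N A] m that abs_Re_le_cmod[of z] by (force simp: p_def)
  have "AE z in zero_distribution p. \<bar>Re z\<bar> \<le> A + 2"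
    using deg bound by (rule AE_zero_distribution) measurable
  thus "AE x in real_zero_distribution p. \<bar>x\<bar> \<le> A + 2"
    unfolding real_zero_distribution_def by (subst AE_distr_iff) auto
  show "cauchy_transform (real_zero_distribution p) z = zero_stieltjes r a N m z" if z: "cmod z \<ge> A + 2"
  proof -
    have "cauchy_transform (real_zero_distribution p) z = (\<integral>w. 1 / (z - w) \<partial>zero_distribution p)"
      unfolding cauchy_transform_def
      by (rule integral_real_zero_distribution[OF deg real]) measurable
    also have "\<dots> = poly (pderiv p) z / (degree p * poly p z)"
      using zero_stieltjes_outside(1)[where a = a and m = m, OF N A z] m deg
      by (intro cauchy_transform_zero_distribution) (auto simp: p_def)
    also have "degree p = N"
      using N m by (simp add: p_def degree_map_poly degree_rescaled_hermite)
    finally show ?thesis by (simp add: zero_stieltjes_def p_def)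
  qed
qed

section \<open>Weak limits and the algebraic equation\<close>

lemma tight_if_bounded:
  assumes "\<And>k. real_distribution (\<mu> k)" "\<And>k. AE x in \<mu> k. \<bar>x\<bar> \<le> B"
  shows "tight \<mu>"
  unfolding tight_def
proof (intro conjI allI impI)
  fix e :: real assume "e > 0"
  have "measure (\<mu> k) {- \<bar>B\<bar> - 1<..\<bar>B\<bar> + 1} > 1 - e" for k
  proof -
    interpret real_distribution "\<mu> k" by (rule assms(1))
    have "AE x in \<mu> k. x \<in> {- \<bar>B\<bar> - 1<..\<bar>B\<bar> + 1}"
      using assms(2)[of k] by eventually_elim auto
    thus ?thesis using \<open>e > 0\<close> by (subst (asm) AE_in_set_eq_1) auto
  qed
  thus "\<exists>a b. a < b \<and> (\<forall>k. 1 - e < measure (\<mu> k) {a<..b})"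
    by (intro exI[of _ "- \<bar>B\<bar> - 1"] exI[of _ "\<bar>B\<bar> + 1"]) auto
qed (rule assms(1))

lemma weak_limit_bounded:
  assumes \<mu>: "\<And>k. real_distribution (\<mu> k)" "\<And>k. AE x in \<mu> k. \<bar>x\<bar> \<le> B"
    and M: "real_distribution M" "weak_conv_m \<mu> M"
  shows "AE x in M. \<bar>x\<bar> \<le> B"
proof -
  interpret real_distribution M by (rule M(1))
  \<comment> \<open>A bounded continuous function that is positive exactly off the interval.\<close>
  let ?f = "\<lambda>x::real. min 1 (max 0 (\<bar>x\<bar> - B))"
  have "(\<lambda>k. \<integral>x. ?f x \<partial>\<mu> k) \<longlonglongrightarrow> (\<integral>x. ?f x \<partial>M)"
    by (rule weak_conv_imp_integral_bdd_continuous_conv[where B = 1, OF \<mu>(1) M(1,2)])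
       (auto intro!: continuous_intros)
  moreover have "(\<integral>x. ?f x \<partial>\<mu> k) = 0" for k
    using \<mu>(2)[of k] by (intro integral_eq_zero_AE) (auto elim!: eventually_mono)
  ultimately have "(\<integral>x. ?f x \<partial>M) = 0"
    by (simp add: LIMSEQ_const_iff)
  moreover have "integrable M ?f"
    by (rule integrable_const_bound[where B = 1]) auto
  ultimately have "AE x in M. ?f x = 0"
    by (subst (asm) integral_nonneg_eq_0_iff_AE) auto
  thus ?thesis by eventually_elim (auto simp: min_def max_def split: if_splits)
qed

text \<open>Clamping \<open>x\<close> to \<open>[-B, B]\<close> turns \<open>1 / (z - x)\<close> into a bounded continuous test function on the
  whole line, without changing the integrals.\<close>

lemma weak_limit_cauchy_transform:
  assumes \<mu>: "\<And>k. real_distribution (\<mu> k)" "\<And>k. AE x in \<mu> k. \<bar>x\<bar> \<le> B"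
    and M: "real_distribution M" "weak_conv_m \<mu> M" and z: "cmod z > B" and B: "B \<ge> 0"
  shows "(\<lambda>k. cauchy_transform (\<mu> k) z) \<longlonglongrightarrow> cauchy_transform M z"
proof -
  let ?f = "\<lambda>x. 1 / (z - of_real (max (- B) (min B x)))"
  have far: "cmod (z - of_real (max (- B) (min B x))) \<ge> cmod z - B" for x
  proof -
    have "cmod (of_real (max (- B) (min B x))) \<le> B" using B by auto
    thus ?thesis using norm_triangle_ineq2[of z "of_real (max (- B) (min B x))"] by linarith
  qed
  have nz: "z - of_real (max (- B) (min B x)) \<noteq> 0" for x
    using far[of x] z by auto
  have "(\<lambda>k. \<integral>x. ?f x \<partial>\<mu> k) \<longlonglongrightarrow> (\<integral>x. ?f x \<partial>M)"
  proof (rule weak_conv_imp_integral_bdd_continuous_conv[where B = "1 / (cmod z - B)", OF \<mu>(1) M(1,2)])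
    show "isCont ?f x" for x
      using nz[of x] by (intro continuous_intros) auto
    show "norm (?f x) \<le> 1 / (cmod z - B)" for x
      using far[of x] z by (simp add: norm_divide frac_le)
  qed
  moreover have "(\<integral>x. ?f x \<partial>L) = cauchy_transform L z" if "real_distribution L" "AE x in L. \<bar>x\<bar> \<le> B"
      for L
  proof -
    interpret L: real_distribution L by fact
    show ?thesis unfolding cauchy_transform_def
      using that(2) by (intro integral_cong_AE) (auto elim!: eventually_mono)
  qed
  ultimately show ?thesis
    using \<mu> M(1) weak_limit_bounded[OF \<mu> M] by simp
qed

text \<open>Cauchy transforms converge along the subsequence, and by \<open>zero_stieltjes_approx\<close> the error in the
  fixed point equation tends to zero.\<close>

lemma hermite_weak_limit:
  assumes n: "path_like r n q" and A: "\<And>j. j \<in> {1..r} \<Longrightarrow> \<bar>a j\<bar> \<le> A" "A \<ge> 0"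
    and s: "strict_mono s" and M: "real_distribution M"
    and lim: "weak_conv_m
        ((\<lambda>k. real_zero_distribution (cpoly (rescaled_hermite r a (Suc k) (n (Suc k))))) \<circ> s) M"
  shows "AE x in M. \<bar>x\<bar> \<le> A + 2"
    and "cmod z \<ge> A + 3 \<Longrightarrow> cmod (cauchy_transform M z) \<le> 1"
    and "cmod z \<ge> A + 3 \<Longrightarrow>
      cauchy_transform M z =
          (\<Sum>j=1..r. of_real (q j) * (1 / (z - of_real (a j) - cauchy_transform M z)))"
proof -
  define N where "N k = Suc (s k)" for k
  define \<mu> where "\<mu> k = real_zero_distribution (cpoly (rescaled_hermite r a (N k) (n (N k))))" for k
  have sum: "(\<Sum>i=1..r. n k i) = k" for k using n by (simp add: path_like_def)
  have N: "N k > 0" for k by (simp add: N_def)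
  have \<mu>: "real_distribution (\<mu> k)" "AE x in \<mu> k. \<bar>x\<bar> \<le> A + 2" for k
    using cauchy_transform_hermite(3)[where a = a, OF N A(1) sum]
    unfolding \<mu>_def by (simp_all add: real_distribution_real_zero_distribution)
  have lim': "weak_conv_m \<mu> M"
    using lim by (simp add: \<mu>_def[abs_def] N_def comp_def)
  show "AE x in M. \<bar>x\<bar> \<le> A + 2"
    by (rule weak_limit_bounded[OF \<mu> M lim'])
  assume z: "cmod z \<ge> A + 3"
  define G where "G k = zero_stieltjes r a (N k) (n (N k)) z" for k
  define w where "w = cauchy_transform M z"
  have z2: "cmod z \<ge> A + 2" "cmod z > A + 2" "A + 2 \<ge> 0" using z A(2) by auto
  have G: "G \<longlonglongrightarrow> w"
    using weak_limit_cauchy_transform[OF \<mu> M lim' z2(2,3)] cauchy_transform_hermite(4)[OF N A(1) sum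
        z2(1)]
    by (simp add: G_def[abs_def] w_def \<mu>_def)
  have bd: "cmod (G k) \<le> 1" for k
    unfolding G_def by (rule zero_stieltjes_outside(2)[OF N A(1) z2(1)]) (simp_all only: sum order.refl)
  show w1: "cmod (cauchy_transform M z) \<le> 1"
    using LIMSEQ_le_const2[OF tendsto_norm[OF G]] bd by (auto simp: w_def)
  have "(\<lambda>k. G k - (\<Sum>j=1..r. of_real (q j) * (1 / (z - of_real (a j) - G k)))) \<longlonglongrightarrow> 0"
  proof (rule Lim_null_comparison)
    show "eventually (\<lambda>k. norm (G k - (\<Sum>j=1..r. of_real (q j) * (1 / (z - of_real (a j) - G k)))) \<le>
        1 / N k + (\<Sum>j=1..r. \<bar>n (N k) j / N k - q j\<bar>)) sequentially"
      unfolding G_def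
      by (intro always_eventually allI zero_stieltjes_approx[OF N A(1) z]) (simp_all only: sum
          order.refl)
    have sub: "filterlim N sequentially sequentially"
      using s by (auto intro!: filterlim_subseq simp: N_def strict_mono_def)
    have "(\<lambda>m. 1 / real m + (\<Sum>j=1..r. \<bar>n m j / m - q j\<bar>)) \<longlonglongrightarrow> 0 + (\<Sum>j=1..r. \<bar>q j - q j\<bar>)"
      using n by (intro tendsto_intros lim_1_over_n) (auto simp: path_like_def)
    thus "(\<lambda>k. 1 / real (N k) + (\<Sum>j=1..r. \<bar>n (N k) j / N k - q j\<bar>)) \<longlonglongrightarrow> 0"
      using filterlim_compose[OF _ sub] by simp
  qed
  moreover have "(\<lambda>k. G k - (\<Sum>j=1..r. of_real (q j) * (1 / (z - of_real (a j) - G k)))) \<longlonglongrightarrow>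
      w - (\<Sum>j=1..r. of_real (q j) * (1 / (z - of_real (a j) - w)))"
  proof (intro tendsto_intros G)
    fix j assume j: "j \<in> {1..r}"
    have "cmod (z - of_real (a j) - w) \<ge> cmod z - \<bar>a j\<bar> - cmod w"
      by (smt (verit) norm_of_real norm_triangle_ineq2)
    thus "z - of_real (a j) - w \<noteq> 0" using A(1)[OF j] w1 z by (auto simp: w_def)
  qed
  ultimately have "w - (\<Sum>j=1..r. of_real (q j) * (1 / (z - of_real (a j) - w))) = 0"
    using LIMSEQ_unique by blast
  thus "cauchy_transform M z =
      (\<Sum>j=1..r. of_real (q j) * (1 / (z - of_real (a j) - cauchy_transform M z)))"
    by (simp add: w_def)
qed

lemma path_like_sum_proportions:
  assumes "path_like r n q"
  shows "(\<Sum>j=1..r. q j) = 1"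
proof -
  have "(\<lambda>N. \<Sum>j=1..r. n N j / N) \<longlonglongrightarrow> (\<Sum>j=1..r. q j)"
    using assms by (intro tendsto_sum) (auto simp: path_like_def)
  moreover have "eventually (\<lambda>N. (\<Sum>j=1..r. n N j / N) = 1) sequentially"
    using eventually_gt_at_top[of 0]
  proof eventually_elim
    case (elim N)
    have "(\<Sum>j=1..r. real (n N j)) = real N"
      using assms by (simp add: path_like_def flip: of_nat_sum)
    thus ?case using elim by (simp flip: sum_divide_distrib)
  qed
  hence "(\<lambda>N. \<Sum>j=1..r. n N j / N) \<longlonglongrightarrow> 1"
    by (rule tendsto_eventually)
  ultimately show ?thesis by (rule LIMSEQ_unique)
qed

text \<open>The fixed point equation near infinity gives \<open>M\<close> the R-transform that the convolution must have.
  Since a compactly supported law is determined by its R-transform, the definite description picks \<open>M\<close>;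
  so the existence of the convolution comes from the existence of weak limits.\<close>

lemma free_convolution_semicircle_eqI:
  assumes q: "\<And>j. j \<in> {1..r} \<Longrightarrow> q j \<ge> 0" "(\<Sum>j=1..r. q j) = 1"
    and M: "real_distribution M" "AE x in M. \<bar>x\<bar> \<le> B"
    and eq: "\<And>z. cmod z \<ge> C \<Longrightarrow>
      cauchy_transform M z =
          (\<Sum>j=1..r. of_real (q j) * (1 / (z - of_real (a j) - cauchy_transform M z)))"
  shows "semicircle \<boxplus> atomic_measure r q a = M"
proof -
  have of_real: "cauchy_transform M (of_real z) = of_real (\<integral>x. 1 / (z - x) \<partial>M)" for z
  proof -
    have "cauchy_transform M (of_real z) = (\<integral>x. complex_of_real (1 / (z - x)) \<partial>M)"
      unfolding cauchy_transform_def by simp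
    thus ?thesis by (simp only: integral_complex_of_real)
  qed
  have "cauchy_series M = (\<Sum>j=1..r. fps_const (q j) *
      (fps_X * inverse (1 - fps_const (a j) * fps_X - fps_X * cauchy_series M)))"
  proof (rule cauchy_series_functional_equation[OF M])
    fix z :: real assume "z > C \<or> z < - C"
    hence "cmod (of_real z) \<ge> C" by auto
    from eq[OF this] have "complex_of_real (\<integral>x. 1 / (z - x) \<partial>M) =
        complex_of_real (\<Sum>j=1..r. q j / (z - a j - (\<integral>x. 1 / (z - x) \<partial>M)))"
      unfolding of_real by simp
    thus "(\<integral>x. 1 / (z - x) \<partial>M) = (\<Sum>j=1..r. q j / (z - a j - (\<integral>x. 1 / (z - x) \<partial>M)))"
      by (simp only: of_real_eq_iff)
  qed
  with q M(1) have "K_series M = K_series (atomic_measure r q a) + fls_X"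
    by (intro K_series_subordination) simp_all
  hence R: "R_transform M = R_transform semicircle + R_transform (atomic_measure r q a)"
    by (simp add: R_transform_def[of M] R_transform_def[of "atomic_measure r q a"]
        R_transform_semicircle)
  have C: "compactly_supported_prob M"
    using M by (auto simp: compactly_supported_prob_iff)
  show ?thesis
    unfolding free_additive_convolution_def
    by (rule the_equality) (use R C R_transform_determines in auto)
qed

theorem corollary3p6:
  fixes r :: nat and a q :: "nat \<Rightarrow> real" and n :: "nat \<Rightarrow> nat \<Rightarrow> nat"
    and \<nu>\<^sub>N :: "nat \<Rightarrow> complex measure" and \<nu> :: "real measure"
    and P :: "complex \<Rightarrow> complex \<Rightarrow> complex"
  assumes "r \<ge> 2"
    and "inj_on a {1..r}"
    and "path_like r n q"
    and "\<And>N. \<nu>\<^sub>N N = zero_distribution (map_poly complex_of_real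
                 (multiple_hermite r (\<lambda>j. sqrt (real N) * a j) (n N) \<circ>\<^sub>p [:0, sqrt (real N):]))"
    and "\<nu> = semicircle \<boxplus> atomic_measure r q a"
    and "\<And>z w. P z w =
            w * (\<Prod>i=1..r. z - w - complex_of_real (a i))
            - (\<Sum>i=1..r. complex_of_real (q i) * (\<Prod>j\<in>{1..r} - {i}. z - w - complex_of_real (a j)))"
  shows "converges_weakly \<nu>\<^sub>N (distr \<nu> borel complex_of_real) \<and>
         (\<forall>z. z \<notin> complex_of_real ` measure_support \<nu> \<longrightarrow> P z (cauchy_transform \<nu> z) = 0)"
proof -
  \<comment> \<open>Any common bound for the nodes will do.\<close>
  define A where "A = (\<Sum>j=1..r. \<bar>a j\<bar>)"
  have A: "\<bar>a j\<bar> \<le> A" if "j \<in> {1..r}" for j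
    unfolding A_def using that by (intro member_le_sum) auto
  have A0: "A \<ge> 0" unfolding A_def by (intro sum_nonneg) auto
  define p where "p N = cpoly (rescaled_hermite r a N (n N))" for N
  \<comment> \<open>The index starts at one: at zero the polynomial is constant and its zero distribution unspecified.\<close>
  define \<mu> where "\<mu> k = real_zero_distribution (p (Suc k))" for k
  have sum: "(\<Sum>i=1..r. n N i) = N" for N using assms(3) by (simp add: path_like_def)
  note hermite = cauchy_transform_hermite[where a = a, OF zero_less_Suc A sum]
  have zeros: "degree (p (Suc k)) > 0" "\<And>z. poly (p (Suc k)) z = 0 \<Longrightarrow> Im z = 0" "AE x in \<mu> k. \<bar>x\<bar> \<le>
      A + 2" for k
    unfolding p_def \<mu>_def
    by (rule hermite(1), assumption, rule hermite(2), assumption, assumption, rule hermite(3),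
        assumption)
  have \<mu>: "real_distribution (\<mu> k)" for k
    by (simp add: \<mu>_def real_distribution_real_zero_distribution)
  have tight: "tight \<mu>" by (rule tight_if_bounded[OF \<mu> zeros(3)])
  have \<nu>\<^sub>N: "\<nu>\<^sub>N (Suc k) = zero_distribution (p (Suc k))" for k
  proof -
    have "inj_on (\<lambda>j. sqrt (real (Suc k)) * a j) {1..r}"
      by (intro inj_onI) (simp add: inj_on_eq_iff[OF assms(2)] del: of_nat_Suc)
    thus ?thesis
      by (simp add: assms(4) multiple_hermite_eq p_def rescaled_hermite_def)
  qed
  have q: "\<And>j. j \<in> {1..r} \<Longrightarrow> q j \<ge> 0" "(\<Sum>j=1..r. q j) = 1"
    using assms(3) unfolding path_like_def
    by (meson less_imp_le) (rule path_like_sum_proportions[OF assms(3)])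
  have limit: "\<nu> = M" if "strict_mono s" "real_distribution M" "weak_conv_m (\<mu> \<circ> s) M" for s M
  proof -
    have w: "weak_conv_m
        ((\<lambda>k. real_zero_distribution (cpoly (rescaled_hermite r a (Suc k) (n (Suc k))))) \<circ> s) M"
      using that(3) by (simp add: \<mu>_def[abs_def] p_def)
    show ?thesis
      unfolding assms(5)
      by (rule free_convolution_semicircle_eqI[OF q that(2)
            hermite_weak_limit(1)[OF assms(3) A A0 that(1,2) w] hermite_weak_limit(3)[OF assms(3) A
                A0 that(1,2) w]])
  qed
  obtain s M where s: "strict_mono s" and M: "real_distribution M" "weak_conv_m (\<mu> \<circ> s) M"
    using tight_imp_convergent_subsubsequence[OF tight strict_mono_id] by (auto simp: comp_def id_def)
  have "\<nu> = M" by (rule limit[OF s M])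
  note M = M[folded this]
  have "weak_conv_m ((\<lambda>k. real_zero_distribution (cpoly (rescaled_hermite r a (Suc k) (n (Suc k)))))
      \<circ> s) \<nu>"
    using M(2) by (simp add: \<mu>_def[abs_def] p_def)
  note lim = hermite_weak_limit[where a = a, OF assms(3) A A0 s M(1) this]
  have \<nu>: "AE x in \<nu>. \<bar>x\<bar> \<le> A + 2"
    "\<And>z. cmod z \<ge> A + 3 \<Longrightarrow> cmod (cauchy_transform \<nu> z) \<le> 1"
    "\<And>z. cmod z \<ge> A + 3 \<Longrightarrow> cauchy_transform \<nu> z =
      (\<Sum>j=1..r. of_real (q j) * (1 / (z - of_real (a j) - cauchy_transform \<nu> z)))"
    by (rule lim; assumption)+
  interpret \<nu>: real_distribution \<nu> by (rule M(1))

  have "weak_conv_m \<mu> \<nu>"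
    using limit by (intro tight_subseq_weak_converge[OF \<mu> M(1) tight]) metis
  have conv: "converges_weakly \<nu>\<^sub>N (distr \<nu> borel complex_of_real)"
    unfolding converges_weakly_def
  proof (intro allI impI)
    fix f :: "complex \<Rightarrow> real" assume f: "continuous_on UNIV f" "bounded (range f)"
    have [measurable]: "f \<in> borel_measurable borel" using f(1) by (rule borel_measurable_continuous_onI)
    obtain B where B: "\<And>z. norm (f z) \<le> B" using f(2) by (auto simp: bounded_iff)
    have "isCont (\<lambda>x. f (complex_of_real x)) x" for x
      by (rule isCont_o2[OF isCont_of_real[OF continuous_ident]])
         (use f(1) in \<open>simp add: continuous_on_eq_continuous_at\<close>)
    from weak_conv_imp_integral_bdd_continuous_conv[OF \<mu> M(1) \<open>weak_conv_m \<mu> \<nu>\<close> this B]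
    have "(\<lambda>k. \<integral>x. f (complex_of_real x) \<partial>\<mu> k) \<longlonglongrightarrow> (\<integral>x. f (complex_of_real x) \<partial>\<nu>)" .
    also have "(\<lambda>k. \<integral>x. f (complex_of_real x) \<partial>\<mu> k) = (\<lambda>k. \<integral>z. f z \<partial>\<nu>\<^sub>N (Suc k))"
      unfolding \<nu>\<^sub>N \<mu>_def by (intro ext integral_real_zero_distribution zeros(1,2)) measurable
    also have "(\<integral>x. f (complex_of_real x) \<partial>\<nu>) = (\<integral>z. f z \<partial>distr \<nu> borel complex_of_real)"
      by (rule integral_distr[symmetric]) measurable
    finally show "(\<lambda>N. \<integral>z. f z \<partial>\<nu>\<^sub>N N) \<longlonglongrightarrow> (\<integral>z. f z \<partial>distr \<nu> borel complex_of_real)"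
      by (rule LIMSEQ_imp_Suc)
  qed

  let ?S = "- (complex_of_real ` measure_support \<nu>)" and ?D = "{z. cmod z > A + 3}"
  have supp: "measure_support \<nu> \<subseteq> {- (A + 2)..A + 2}"
    using \<nu>(1) by (intro measure_support_subset) (auto elim!: eventually_mono)
  have closed: "closed (complex_of_real ` measure_support \<nu>)"
    using closed_measure_support
    by (intro closed_injective_linear_image) (auto intro: linearI simp: scaleR_conv_of_real inj_on_def)
  have "P z (cauchy_transform \<nu> z) = 0" if "z \<in> ?S" for z
  proof (rule analytic_continuation_open[where s = ?D and s' = ?S
        and f = "\<lambda>z. P z (cauchy_transform \<nu> z)" and g = "\<lambda>_. 0"])
    show "open ?D" by (intro open_Collect_less continuous_intros)
    show "open ?S" using closed by (rule open_Compl)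
    have "complex_of_real (A + 4) \<in> ?D" using A0 by simp
    thus "?D \<noteq> {}" by blast
    show "connected ?S"
      by (rule connected_Compl_real_set[OF bounded_subset[OF bounded_closed_interval supp]])
    show "?D \<subseteq> ?S" using supp A0 by (force dest: subsetD)
    show "(\<lambda>z. P z (cauchy_transform \<nu> z)) holomorphic_on ?S"
      unfolding assms(6) by (intro holomorphic_intros holomorphic_cauchy_transform[OF M(1)])
    show "P z (cauchy_transform \<nu> z) = 0" if "z \<in> ?D" for z
    proof -
      define w where "w = cauchy_transform \<nu> z"
      have z: "cmod z \<ge> A + 3" using that by simp
      have nz: "z - w - of_real (a j) \<noteq> 0" if "j \<in> {1..r}" for j
      proof
        assume "z - w - of_real (a j) = 0"
        hence "z = w + of_real (a j)" by (simp add: algebra_simps)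
        hence "cmod z \<le> cmod w + \<bar>a j\<bar>" using norm_triangle_ineq[of w "of_real (a j)"] by simp
        thus False using z A[OF that] \<nu>(2)[OF z] by (simp add: w_def)
      qed
      have "w = (\<Sum>j=1..r. of_real (q j) * (1 / (z - of_real (a j) - w)))"
        using \<nu>(3)[OF z] by (simp add: w_def)
      hence "w * (\<Prod>i=1..r. z - w - of_real (a i)) =
          (\<Sum>j=1..r. of_real (q j) * (1 / (z - of_real (a j) - w))) * (\<Prod>i=1..r. z - w - of_real (a i))"
        by (rule arg_cong)
      also have "\<dots> = (\<Sum>j=1..r. of_real (q j) * (\<Prod>i\<in>{1..r} - {j}. z - w - of_real (a i)))"
        unfolding sum_distrib_right
      proof (intro sum.cong refl)
        fix j assume j: "j \<in> {1..r}"
        have "(\<Prod>i=1..r. z - w - of_real (a i)) =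
            (z - w - of_real (a j)) * (\<Prod>i\<in>{1..r} - {j}. z - w - of_real (a i))"
          using j by (intro prod.remove) auto
        moreover have eq: "z - of_real (a j) - w = z - w - of_real (a j)" by simp
        ultimately show "of_real (q j) * (1 / (z - of_real (a j) - w)) * (\<Prod>i=1..r. z - w - of_real
            (a i)) =
            of_real (q j) * (\<Prod>i\<in>{1..r} - {j}. z - w - of_real (a i))"
          unfolding eq using nz[OF j] by simp
      qed
      finally show ?thesis by (simp add: assms(6) w_def)
    qed
  qed (use that in auto)
  with conv show ?thesis by blast
qed

end
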